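(* Let $L$ be a completely regular frame, let $\mathfrak{B}(L)$ be its Booleanization and $\beta\colon L\to\mathfrak{B}(L)$, $\beta(a)=a^{\ast\ast}$. Then the map $\Upsilon\colon \mathrm{C}(L)\to\mathrm{C}(\mathfrak{B}(L))$ given by $\Upsilon(f)=\beta\circ f$ is the universal completion of $\mathrm{C}(L)$; that is, $\mathrm{C}(\mathfrak{B}(L))$ is a universally complete Riesz space, $\Upsilon$ is a Riesz space embedding, and for every $h\in\mathrm{C}(\mathfrak{B}(L))$ with $h\ge \boldsymbol{0}$ one has $h=\bigvee\{\Upsilon(g)\mid g\in\mathrm{C}(L),\ \boldsymbol{0}\le\Upsilon(g)\le h\}$ (supremum in $\mathrm{C}(\mathfrak{B}(L))$).
   Context: Frames: a frame is a complete lattice $L$ with $a\wedge\bigvee B=\bigvee\{a\wedge b\mid b\in B\}$; a frame homomorphism preserves finite meets (including $1$) and arbitrary joins (including $0$). The pseudocomplement is $a^\ast=\bigvee\{b\mid a\wedge b=0\}$. Write $b\prec a$ if $b^\ast\vee a=1$, and $b\prec\!\!\prec a$ if there are $c_r\in L$ ($r\in\mathbb{Q}\cap[0,1]$) with $b\le c_0$, $c_1\le a$ and $c_r\prec c_s$ whenever $r<s$. $L$ is completely regular if $a=\bigvee\{b\mid b\prec\!\!\prec a\}$ for all $a\in L$. Booleanization: $\mathfrak{B}(L)=\{a\in L\mid a=a^{\ast\ast}\}$, a complete Boolean algebra (hence a frame) with the order of $L$; meets are as in $L$, joins are $\bigvee^{\mathfrak{B}(L)}A=(\bigvee^L A)^{\ast\ast}$;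 $\beta(a)=a^{\ast\ast}$ is a frame homomorphism. Continuous real functions: the frame of reals $\mathfrak{L}(\mathbb{R})$ is the frame presented by generators $(p,-)$ and $(-,p)$, $p\in\mathbb{Q}$, with relations (r1) $(p,-)\wedge(-,q)=0$ if $p\ge q$; (r2) $(p,-)\vee(-,q)=1$ if $p<q$; (r3) $(p,-)=\bigvee_{q>p}(q,-)$; (r4) $(-,p)=\bigvee_{q<p}(-,q)$; (r5) $\bigvee_{p}(p,-)=1$; (r6) $\bigvee_{p}(-,p)=1$. $\mathrm{C}(L)$ is the set of frame homomorphisms $\mathfrak{L}(\mathbb{R})\to L$, ordered by $f\le g$ iff $f(p,-)\le g(p,-)$ for all $p\in\mathbb{Q}$. It is an Archimedean Riesz space with $(f\vee g)(p,-)=f(p,-)\vee g(p,-)$, $(f\wedge g)(p,-)=f(p,-)\wedge g(p,-)$, $(f+g)(p,-)=\bigvee_{r\in\mathbb{Q}}f(r,-)\wedge g(p-r,-)$, $(f+g)(-,q)=\bigvee_{s\in\mathbb{Q}}f(-,s)\wedge g(-,q-s)$, $(-f)(p,-)=f(-,-p)$, $(-f)(-,q)=f(-q,-)$, and for $\lambda>0$ $(\lambda f)(p,-)=\bigvee\{f(r,-)\mid r\in\mathbb{Q},\lambda r>p\}$, $(\lambda f)(-,q)=\bigvee\{f(-,s)\mid s\in\mathbb{Q},\lambda s<q\}$ (so for rational $\lambda>0$, $(\lambda f)(p,-)=f(p/\lambda,-)$). The constant function $\boldsymbol{r}$, $r\in\mathbb{Q}$: $\boldsymbol{r}(p,-)=1$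 if $p<r$ and $0$ otherwise; $\boldsymbol{r}(-,q)=1$ if $q>r$ and $0$ otherwise. Riesz spaces: $R$ is Dedekind complete if every nonempty subset bounded above has a supremum; laterally complete if every nonempty set of pairwise disjoint elements of $R^+$ ($g\wedge h=0$ for distinct $g,h$) has a supremum; universally complete if both. A universal completion of $R$ is a pair $(\mathcal{U}(R),\mu)$ with $\mathcal{U}(R)$ a universally complete Riesz space and $\mu\colon R\to\mathcal{U}(R)$ a Riesz space embedding (injective linear lattice homomorphism) such that $f=\bigvee\{\mu(g)\mid g\in R,\ 0\le\mu(g)\le f\}$ for all $f\in\mathcal{U}(R)^+$. *)

theory Defs
  imports Complex_Main "HOL-Library.FSet" "HOL-Algebra.Group"
begin

(* HOL-Algebra's lattice operations on carriers would otherwise shadow those of the type classes. *)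
hide_const (open) Lattice.inf Lattice.sup Order.top Order.bottom

section \<open>Frames\<close>

class frame = complete_lattice +
  assumes inf_Sup_frame: "inf a (Sup B) = (SUP b\<in>B. inf a b)"

text \<open>Preservation of the bottom element is the case \<open>A = {}\<close> of the last clause.\<close>

definition frame_hom :: "('a::frame \<Rightarrow> 'b::frame) \<Rightarrow> bool" where
  "frame_hom h \<longleftrightarrow> h top = top \<and> (\<forall>a b. h (inf a b) = inf (h a) (h b)) \<and>
     (\<forall>A. h (Sup A) = (SUP a\<in>A. h a))"

definition pseudocomplement :: "'a::frame \<Rightarrow> 'a" where
  "pseudocomplement a = Sup {b. inf a b = bot}"

definition rather_below :: "'a::frame \<Rightarrow> 'a \<Rightarrow> bool" where
  "rather_below b a \<longleftrightarrow> sup (pseudocomplement b) a = top"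

definition completely_below :: "'a::frame \<Rightarrow> 'a \<Rightarrow> bool" where
  "completely_below b a \<longleftrightarrow> (\<exists>c :: rat \<Rightarrow> 'a. b \<le> c 0 \<and> c 1 \<le> a \<and>
     (\<forall>r s. 0 \<le> r \<longrightarrow> r < s \<longrightarrow> s \<le> 1 \<longrightarrow> rather_below (c r) (c s)))"

definition completely_regular :: "'a::frame itself \<Rightarrow> bool" where
  "completely_regular _ \<longleftrightarrow> (\<forall>a::'a. a = Sup {b. completely_below b a})"


section \<open>Booleanization\<close>

lemma inf_SUP_frame: "inf a (SUP i\<in>I. f i) = (SUP i\<in>I. inf a (f i))" for a :: "'a::frame"
  by (simp add: inf_Sup_frame image_image)

lemma SUP_inf_frame: "inf (SUP i\<in>I. f i) a = (SUP i\<in>I. inf (f i) a)" for a :: "'a::frame"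
  using inf_SUP_frame[of a f I] by (simp add: inf_commute)

lemma le_pseudocomplement: "b \<le> pseudocomplement a \<longleftrightarrow> inf a b = bot"
proof
  assume "b \<le> pseudocomplement a"
  then have "inf a b \<le> inf a (pseudocomplement a)" by (rule inf_mono[OF order_refl])
  also have "\<dots> = bot" unfolding pseudocomplement_def inf_Sup_frame
    by (auto intro!: antisym SUP_least)
  finally show "inf a b = bot" by (simp add: bot_unique)
qed (auto simp: pseudocomplement_def intro: Sup_upper)

abbreviation regularize :: "'a::frame \<Rightarrow> 'a" where
  "regularize a \<equiv> pseudocomplement (pseudocomplement a)"

lemma inf_pseudocomplement [simp]: "inf a (pseudocomplement a) = bot"
  using le_pseudocomplement by blast

lemma pseudocomplement_antimono: "a \<le> b \<Longrightarrow> pseudocomplement b \<le> pseudocomplement a"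
  unfolding le_pseudocomplement by (metis bot_unique inf_mono inf_pseudocomplement order_refl)

lemma le_regularize: "a \<le> regularize a"
  unfolding le_pseudocomplement by (simp add: inf_commute)

lemma regularize_mono: "a \<le> b \<Longrightarrow> regularize a \<le> regularize b"
  by (intro pseudocomplement_antimono)

lemma pseudocomplement_regularize [simp]:
  "pseudocomplement (regularize a) = pseudocomplement a"
  by (intro antisym le_regularize pseudocomplement_antimono)

lemma inf_regularize: "inf (regularize a) (regularize b) = regularize (inf a b)"
proof (rule antisym)
  let ?c = "pseudocomplement (inf a b)"
  have *: "inf x (inf (regularize y) z) = bot" if "inf x (inf y z) = bot" for x y z :: 'a
  proof -
    have "inf y (inf x z) = bot" using that by (simp add: inf_left_commute)
    then have "inf x z \<le> pseudocomplement y" unfolding le_pseudocomplement .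
    then have "inf (regularize y) (inf x z) = bot"
      by (simp add: le_pseudocomplement[symmetric])
    then show ?thesis by (simp add: inf_left_commute)
  qed
  have "inf ?c (inf a b) = bot" by (simp add: inf_commute)
  then have "inf ?c (inf (regularize a) b) = bot" by (rule *)
  then have "inf ?c (inf b (regularize a)) = bot" by (simp add: inf_commute)
  then have "inf ?c (inf (regularize b) (regularize a)) = bot" by (rule *)
  then show "inf (regularize a) (regularize b) \<le> regularize (inf a b)"
    unfolding le_pseudocomplement by (simp add: inf_commute)
qed (intro le_infI regularize_mono; simp)

lemma regularize_bot: "regularize bot = (bot :: 'a::frame)"
proof -
  have "pseudocomplement bot = (top :: 'a)"
    by (simp add: top_unique[symmetric] le_pseudocomplement)
  moreover have "pseudocomplement top = (bot :: 'a)"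
    by (metis inf_top_left inf_pseudocomplement)
  ultimately show ?thesis by simp
qed

typedef (overloaded) 'a booleanization = "{a :: 'a::frame. a = regularize a}"
  by (rule exI[of _ "pseudocomplement bot"]) simp

setup_lifting type_definition_booleanization

lemma regular_Inf:
  assumes "\<And>a. a \<in> A \<Longrightarrow> a = regularize a" shows "Inf A = regularize (Inf A)"
proof (intro antisym le_regularize Inf_greatest)
  fix a assume "a \<in> A"
  then have "regularize (Inf A) \<le> regularize a" by (intro regularize_mono Inf_lower)
  with assms[OF \<open>a \<in> A\<close>] show "regularize (Inf A) \<le> a" by simp
qed

instantiation booleanization :: (frame) frame
begin

lift_definition less_eq_booleanization :: "'a booleanization \<Rightarrow> 'a booleanization \<Rightarrow> bool" is "(\<le>)" .
lift_definition less_booleanization :: "'a booleanization \<Rightarrow> 'a booleanization \<Rightarrow> bool" is "(<)" .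
lift_definition top_booleanization :: "'a booleanization" is top
  by (intro antisym le_regularize top_greatest)
lift_definition bot_booleanization :: "'a booleanization" is bot
  by (rule regularize_bot[symmetric])
lift_definition inf_booleanization :: "'a booleanization \<Rightarrow> 'a booleanization \<Rightarrow> 'a booleanization" is inf
  by (metis inf_regularize)
lift_definition sup_booleanization :: "'a booleanization \<Rightarrow> 'a booleanization \<Rightarrow> 'a booleanization"
  is "\<lambda>a b. regularize (sup a b)" by simp
lift_definition Inf_booleanization :: "'a booleanization set \<Rightarrow> 'a booleanization" is Inf
  by (rule regular_Inf) blast
lift_definition Sup_booleanization :: "'a booleanization set \<Rightarrow> 'a booleanization"
  is "\<lambda>A. regularize (Sup A)" by simp

instance
proof
  fix x y z :: "'a booleanization" and A B :: "'a booleanization set"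
  show "x < y \<longleftrightarrow> x \<le> y \<and> \<not> y \<le> x" by transfer (rule less_le_not_le)
  show "x \<le> x" by transfer simp
  show "x \<le> y \<Longrightarrow> y \<le> z \<Longrightarrow> x \<le> z" by transfer (rule order_trans)
  show "x \<le> y \<Longrightarrow> y \<le> x \<Longrightarrow> x = y" by transfer (rule antisym)
  show "inf x y \<le> x" "inf x y \<le> y" by (transfer; simp)+
  show "x \<le> y \<Longrightarrow> x \<le> z \<Longrightarrow> x \<le> inf y z" by transfer simp
  show "x \<le> sup x y" by transfer (rule order_trans[OF sup_ge1 le_regularize])
  show "y \<le> sup x y" by transfer (rule order_trans[OF sup_ge2 le_regularize])
  show "y \<le> x \<Longrightarrow> z \<le> x \<Longrightarrow> sup y z \<le> x" by transfer (metis regularize_mono le_sup_iff)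
  show "x \<in> A \<Longrightarrow> Inf A \<le> x" by transfer (rule Inf_lower)
  show "(\<And>x. x \<in> A \<Longrightarrow> z \<le> x) \<Longrightarrow> z \<le> Inf A" by transfer (auto intro: Inf_greatest)
  show "x \<in> A \<Longrightarrow> x \<le> Sup A" by transfer (rule order_trans[OF Sup_upper le_regularize])
  show "Sup A \<le> z" if "\<And>x. x \<in> A \<Longrightarrow> x \<le> z"
    using that
  proof transfer
    fix A :: "'a set" and z
    assume z: "z = regularize z" and le: "\<And>x. x = regularize x \<Longrightarrow> x \<in> A \<Longrightarrow> x \<le> z"
      and A: "\<forall>x\<in>A. x = regularize x"
    have "Sup A \<le> z" using le A by (auto intro!: Sup_least)
    then show "regularize (Sup A) \<le> z" using z regularize_mono by metis
  qed
  show "Inf {} = (top :: 'a booleanization)" by transfer simp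
  show "Sup {} = (bot :: 'a booleanization)"
    by transfer (simp add: regularize_bot)
  show "inf x (Sup A) = (SUP b\<in>A. inf x b)"
  proof transfer
    fix x :: 'a and A :: "'a set"
    assume x: "x = regularize x"
    have "inf x (regularize (Sup A)) = regularize (inf x (Sup A))"
      using x inf_regularize by metis
    then show "inf x (regularize (Sup A)) = regularize (Sup (inf x ` A))"
      by (simp add: inf_Sup_frame)
  qed
qed

end

lift_definition booleanize :: "'a::frame \<Rightarrow> 'a booleanization" is regularize
  by simp


section \<open>Presentation of frames\<close>

text \<open>
  The free frame on \<open>'g\<close>: the down-sets of the free meet-semilattice on \<open>'g\<close>, whose elements are
  the finite subsets of \<open>'g\<close> under reverse inclusion (the finite set \<open>F\<close> is the meet of its elements).
\<close>

typedef 'g free_frame = "{U :: 'g fset set. \<forall>F\<in>U. \<forall>F'. F |\<subseteq>| F' \<longrightarrow> F' \<in> U}"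
  by blast

setup_lifting type_definition_free_frame

instantiation free_frame :: (type) frame
begin

lift_definition less_eq_free_frame :: "'a free_frame \<Rightarrow> 'a free_frame \<Rightarrow> bool" is "(\<subseteq>)" .
lift_definition less_free_frame :: "'a free_frame \<Rightarrow> 'a free_frame \<Rightarrow> bool" is "(\<subset>)" .
lift_definition top_free_frame :: "'a free_frame" is UNIV by blast
lift_definition bot_free_frame :: "'a free_frame" is "{}" by blast
lift_definition inf_free_frame :: "'a free_frame \<Rightarrow> 'a free_frame \<Rightarrow> 'a free_frame" is "(\<inter>)" by blast
lift_definition sup_free_frame :: "'a free_frame \<Rightarrow> 'a free_frame \<Rightarrow> 'a free_frame" is "(\<union>)" by blast
lift_definition Inf_free_frame :: "'a free_frame set \<Rightarrow> 'a free_frame" is Inter by blast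
lift_definition Sup_free_frame :: "'a free_frame set \<Rightarrow> 'a free_frame" is Union by blast

instance
proof
  fix x y z :: "'a free_frame" and A :: "'a free_frame set"
  note reps = less_eq_free_frame.rep_eq less_free_frame.rep_eq top_free_frame.rep_eq
    bot_free_frame.rep_eq inf_free_frame.rep_eq sup_free_frame.rep_eq Inf_free_frame.rep_eq
    Sup_free_frame.rep_eq Rep_free_frame_inject[symmetric]
  show "x < y \<longleftrightarrow> x \<le> y \<and> \<not> y \<le> x" unfolding reps by blast
  show "x \<le> x" unfolding reps by blast
  show "x \<le> y \<Longrightarrow> y \<le> z \<Longrightarrow> x \<le> z" unfolding reps by blast
  show "x \<le> y \<Longrightarrow> y \<le> x \<Longrightarrow> x = y" unfolding reps by blast
  show "inf x y \<le> x" "inf x y \<le> y" unfolding reps by blast+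
  show "x \<le> y \<Longrightarrow> x \<le> z \<Longrightarrow> x \<le> inf y z" unfolding reps by blast
  show "x \<le> sup x y" "y \<le> sup x y" unfolding reps by blast+
  show "y \<le> x \<Longrightarrow> z \<le> x \<Longrightarrow> sup y z \<le> x" unfolding reps by blast
  show "x \<in> A \<Longrightarrow> Inf A \<le> x" unfolding reps by blast
  show "(\<And>x. x \<in> A \<Longrightarrow> z \<le> x) \<Longrightarrow> z \<le> Inf A" unfolding reps by blast
  show "x \<in> A \<Longrightarrow> x \<le> Sup A" unfolding reps by blast
  show "(\<And>x. x \<in> A \<Longrightarrow> x \<le> z) \<Longrightarrow> Sup A \<le> z" unfolding reps by blast
  show "Inf {} = (top :: 'a free_frame)" unfolding reps by blast
  show "Sup {} = (bot :: 'a free_frame)" unfolding reps by blast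
  show "inf x (Sup A) = (SUP b\<in>A. inf x b)" unfolding reps by (auto simp: inf_free_frame.rep_eq)
qed

end

lift_definition free_gen :: "'g \<Rightarrow> 'g free_frame" is "\<lambda>g. {F. g |\<in>| F}"
  by auto

text \<open>
  The quotient of a frame by the least congruence containing \<open>R\<close> is represented by the largest
  elements of the congruence classes; these are exactly the \<open>R\<close>-saturated elements, and the class of
  \<open>x\<close> is represented by the least saturated element above \<open>x\<close>.
\<close>

definition saturated :: "('a::frame \<times> 'a) set \<Rightarrow> 'a \<Rightarrow> bool" where
  "saturated R x \<longleftrightarrow> (\<forall>(a, b)\<in>R. \<forall>c. inf a c \<le> x \<longleftrightarrow> inf b c \<le> x)"

definition saturation :: "('a::frame \<times> 'a) set \<Rightarrow> 'a \<Rightarrow> 'a" where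
  "saturation R x = Inf {y. saturated R y \<and> x \<le> y}"

lemma saturated_Inf: "(\<And>x. x \<in> X \<Longrightarrow> saturated R x) \<Longrightarrow> saturated R (Inf X)"
  unfolding saturated_def by (simp add: le_Inf_iff) blast

lemma saturated_saturation [simp]: "saturated R (saturation R x)"
  unfolding saturation_def by (rule saturated_Inf) simp

lemma le_saturation: "x \<le> saturation R x"
  unfolding saturation_def by (rule Inf_greatest) simp

lemma saturation_least: "saturated R y \<Longrightarrow> x \<le> y \<Longrightarrow> saturation R x \<le> y"
  unfolding saturation_def by (rule Inf_lower) simp

lemma saturation_le_iff: "saturated R y \<Longrightarrow> saturation R x \<le> y \<longleftrightarrow> x \<le> y"
  using saturation_least le_saturation order_trans by blast

lemma saturation_id: "saturated R x \<Longrightarrow> saturation R x = x"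
  by (intro antisym saturation_least le_saturation order_refl)

lemma saturation_mono: "x \<le> y \<Longrightarrow> saturation R x \<le> saturation R y"
  by (meson le_saturation order_trans saturated_saturation saturation_least)

lemma inf_saturation_le:
  assumes s: "saturated R s" and le: "inf x y \<le> s"
  shows "inf (saturation R x) y \<le> s"
proof -
  define t where "t = Sup {z. inf z y \<le> s}"
  have ty: "inf t y \<le> s"
    unfolding t_def inf_commute[of _ y] inf_Sup_frame by (auto intro: SUP_least simp: inf_commute)
  have t: "z \<le> t \<longleftrightarrow> inf z y \<le> s" for z
  proof
    assume "z \<le> t"
    then have "inf z y \<le> inf t y" by (rule inf_mono) simp
    also note ty
    finally show "inf z y \<le> s" .
  qed (auto simp: t_def intro: Sup_upper)
  have "saturated R t"
    using s unfolding saturated_def t inf_assoc by blast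
  with le show ?thesis by (metis t saturation_least)
qed

lemma saturation_inf: "saturation R (inf x y) = inf (saturation R x) (saturation R y)"
proof (rule antisym)
  have "inf (saturation R x) y \<le> saturation R (inf x y)"
    by (intro inf_saturation_le le_saturation saturated_saturation)
  then have "inf (saturation R y) (saturation R x) \<le> saturation R (inf x y)"
    by (intro inf_saturation_le saturated_saturation) (simp add: inf_commute)
  then show "inf (saturation R x) (saturation R y) \<le> saturation R (inf x y)"
    by (simp add: inf_commute)
qed (intro le_infI saturation_mono; simp)


section \<open>The frame of reals\<close>

text \<open>\<open>Above p\<close> stands for the generator $(p,-)$ and \<open>Below p\<close> for $(-,p)$.\<close>

datatype real_generator = Above rat | Below rat

definition real_relations :: "(real_generator free_frame \<times> real_generator free_frame) set" where
  "real_relations =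
     (let A = (\<lambda>p. free_gen (Above p)); B = (\<lambda>p. free_gen (Below p)) in
     {(inf (A p) (B q), bot) | p q. q \<le> p} \<union>
     {(sup (A p) (B q), top) | p q. p < q} \<union>
     {(A p, SUP q\<in>{q. p < q}. A q) | p. True} \<union>
     {(B p, SUP q\<in>{q. q < p}. B q) | p. True} \<union>
     {(SUP p. A p, top), (SUP p. B p, top)})"

typedef real_frame = "{x. saturated real_relations x}"
  using saturated_saturation by blast

setup_lifting type_definition_real_frame

instantiation real_frame :: frame
begin

lift_definition less_eq_real_frame :: "real_frame \<Rightarrow> real_frame \<Rightarrow> bool" is "(\<le>)" .
lift_definition less_real_frame :: "real_frame \<Rightarrow> real_frame \<Rightarrow> bool" is "(<)" .
lift_definition top_real_frame :: real_frame is top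
  by (simp add: saturated_def)
lift_definition bot_real_frame :: real_frame is "saturation real_relations bot"
  by simp
lift_definition inf_real_frame :: "real_frame \<Rightarrow> real_frame \<Rightarrow> real_frame" is inf
  unfolding saturated_def le_inf_iff by blast
lift_definition sup_real_frame :: "real_frame \<Rightarrow> real_frame \<Rightarrow> real_frame"
  is "\<lambda>x y. saturation real_relations (sup x y)" by simp
lift_definition Inf_real_frame :: "real_frame set \<Rightarrow> real_frame" is Inf
  by (rule saturated_Inf) blast
lift_definition Sup_real_frame :: "real_frame set \<Rightarrow> real_frame"
  is "\<lambda>X. saturation real_relations (Sup X)" by simp

instance
proof
  fix x y z :: real_frame and A :: "real_frame set"
  show "x < y \<longleftrightarrow> x \<le> y \<and> \<not> y \<le> x" by transfer (rule less_le_not_le)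
  show "x \<le> x" by transfer simp
  show "x \<le> y \<Longrightarrow> y \<le> z \<Longrightarrow> x \<le> z" by transfer (rule order_trans)
  show "x \<le> y \<Longrightarrow> y \<le> x \<Longrightarrow> x = y" by transfer (rule antisym)
  show "inf x y \<le> x" "inf x y \<le> y" by (transfer; simp)+
  show "x \<le> y \<Longrightarrow> x \<le> z \<Longrightarrow> x \<le> inf y z" by transfer simp
  show "x \<le> sup x y" by transfer (rule order_trans[OF sup_ge1 le_saturation])
  show "y \<le> sup x y" by transfer (rule order_trans[OF sup_ge2 le_saturation])
  show "y \<le> x \<Longrightarrow> z \<le> x \<Longrightarrow> sup y z \<le> x" by transfer (simp add: saturation_least)
  show "x \<in> A \<Longrightarrow> Inf A \<le> x" by transfer (rule Inf_lower)
  show "(\<And>x. x \<in> A \<Longrightarrow> z \<le> x) \<Longrightarrow> z \<le> Inf A" by transfer (auto intro: Inf_greatest)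
  show "x \<in> A \<Longrightarrow> x \<le> Sup A" by transfer (rule order_trans[OF Sup_upper le_saturation])
  show "(\<And>x. x \<in> A \<Longrightarrow> x \<le> z) \<Longrightarrow> Sup A \<le> z"
    by transfer (auto intro!: saturation_least Sup_least)
  show "Inf {} = (top :: real_frame)" by transfer simp
  show "Sup {} = (bot :: real_frame)" by transfer simp
  show "inf x (Sup A) = (SUP b\<in>A. inf x b)"
  proof transfer
    fix x and A :: "real_generator free_frame set"
    assume "saturated real_relations x"
    then have "inf x (saturation real_relations (Sup A)) = saturation real_relations (inf x (Sup A))"
      by (simp add: saturation_inf saturation_id)
    then show "inf x (saturation real_relations (Sup A)) = saturation real_relations (Sup (inf x ` A))"
      by (simp add: inf_Sup_frame)
  qed
qed

end

lift_definition real_gen :: "real_generator \<Rightarrow> real_frame" is "\<lambda>g. saturation real_relations (free_gen g)"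
  by simp

abbreviation above :: "rat \<Rightarrow> real_frame" where "above p \<equiv> real_gen (Above p)"
abbreviation below :: "rat \<Rightarrow> real_frame" where "below p \<equiv> real_gen (Below p)"

text \<open>
  \<open>real_frame\<close> has the universal property of the presented frame: its generators satisfy the
  relations, and assignments on generators satisfying them extend uniquely to frame homomorphisms.
\<close>

definition satisfies_real_relations :: "(real_generator \<Rightarrow> 'a::frame) \<Rightarrow> bool" where
  "satisfies_real_relations \<phi> \<longleftrightarrow>
     (\<forall>p q. q \<le> p \<longrightarrow> inf (\<phi> (Above p)) (\<phi> (Below q)) = bot) \<and>
     (\<forall>p q. p < q \<longrightarrow> sup (\<phi> (Above p)) (\<phi> (Below q)) = top) \<and>
     (\<forall>p. \<phi> (Above p) = (SUP q\<in>{q. p < q}. \<phi> (Above q))) \<and>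
     (\<forall>p. \<phi> (Below p) = (SUP q\<in>{q. q < p}. \<phi> (Below q))) \<and>
     (SUP p. \<phi> (Above p)) = top \<and> (SUP p. \<phi> (Below p)) = top"

lemma frame_homI:
  assumes "h top = top" "\<And>a b. h (inf a b) = inf (h a) (h b)" "\<And>A. h (Sup A) = (SUP a\<in>A. h a)"
  shows "frame_hom h"
  using assms unfolding frame_hom_def by blast

context
  fixes h :: "'a::frame \<Rightarrow> 'b::frame"
  assumes h: "frame_hom h"
begin

lemma frame_hom_top: "h top = top"
  and frame_hom_inf: "h (inf a b) = inf (h a) (h b)"
  and frame_hom_Sup: "h (Sup A) = (SUP a\<in>A. h a)"
  using h unfolding frame_hom_def by blast+

lemma frame_hom_bot: "h bot = bot"
  using frame_hom_Sup[of "{}"] by simp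

lemma frame_hom_sup: "h (sup a b) = sup (h a) (h b)"
  using frame_hom_Sup[of "{a, b}"] by simp

lemma frame_hom_SUP: "h (SUP i\<in>I. f i) = (SUP i\<in>I. h (f i))"
  by (simp add: frame_hom_Sup image_image)

lemma frame_hom_mono: "a \<le> b \<Longrightarrow> h a \<le> h b"
  by (metis frame_hom_inf inf.absorb_iff1)

lemma frame_hom_INF_fset: "h (INF i\<in>fset F. f i) = (INF i\<in>fset F. h (f i))"
  by (induction F) (simp_all add: frame_hom_top frame_hom_inf)

end

lemma frame_hom_comp: "frame_hom g \<Longrightarrow> frame_hom h \<Longrightarrow> frame_hom (g \<circ> h)"
  unfolding frame_hom_def by (simp add: image_image)

lemma SUP_inf_SUP_frame:
  "inf (SUP i\<in>I. f i) (SUP j\<in>J. g j) = (SUP i\<in>I. SUP j\<in>J. inf (f i) (g j))"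
  for f :: "_ \<Rightarrow> 'a::frame"
  by (simp only: SUP_inf_frame) (simp only: inf_SUP_frame)

definition free_lift :: "('g \<Rightarrow> 'a::frame) \<Rightarrow> 'g free_frame \<Rightarrow> 'a" where
  "free_lift \<phi> U = (SUP F\<in>Rep_free_frame U. INF g\<in>fset F. \<phi> g)"

lemma Rep_free_frame_up: "F \<in> Rep_free_frame U \<Longrightarrow> F |\<subseteq>| F' \<Longrightarrow> F' \<in> Rep_free_frame U"
  using Rep_free_frame[of U] by blast

lemma free_lift_hom: "frame_hom (free_lift \<phi>)"
proof (rule frame_homI)
  let ?m = "\<lambda>F. INF g\<in>fset F. \<phi> g"
  show "free_lift \<phi> top = top"
    unfolding free_lift_def top_free_frame.rep_eq
    by (rule top_le[OF order_trans[OF _ SUP_upper[of "{||}"]]]) simp_all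
  show "free_lift \<phi> (inf U V) = inf (free_lift \<phi> U) (free_lift \<phi> V)" for U V
  proof (rule antisym)
    have "inf (?m F) (?m G) \<le> free_lift \<phi> (inf U V)"
      if "F \<in> Rep_free_frame U" "G \<in> Rep_free_frame V" for F G
    proof -
      have "F |\<union>| G \<in> Rep_free_frame (inf U V)"
        using that Rep_free_frame_up by (fastforce simp: inf_free_frame.rep_eq)
      then have "?m (F |\<union>| G) \<le> free_lift \<phi> (inf U V)"
        unfolding free_lift_def by (rule SUP_upper)
      moreover have "?m (F |\<union>| G) = inf (?m F) (?m G)"
        by (simp add: INF_union)
      ultimately show ?thesis by simp
    qed
    then show "inf (free_lift \<phi> U) (free_lift \<phi> V) \<le> free_lift \<phi> (inf U V)"
      unfolding free_lift_def[of \<phi> U] free_lift_def[of \<phi> V] SUP_inf_SUP_frame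
      by (intro SUP_least)
    show "free_lift \<phi> (inf U V) \<le> inf (free_lift \<phi> U) (free_lift \<phi> V)"
      unfolding free_lift_def inf_free_frame.rep_eq by (intro le_infI SUP_subset_mono) auto
  qed
  show "free_lift \<phi> (Sup A) = (SUP U\<in>A. free_lift \<phi> U)" for A
    unfolding free_lift_def Sup_free_frame.rep_eq by (simp add: SUP_UNION)
qed

lemma free_lift_gen: "free_lift \<phi> (free_gen g) = \<phi> g"
  unfolding free_lift_def free_gen.rep_eq
proof (rule antisym)
  show "\<phi> g \<le> (SUP F\<in>{F. g |\<in>| F}. INF g\<in>fset F. \<phi> g)"
    by (rule order_trans[OF _ SUP_upper[of "{|g|}"]]) simp_all
qed (auto intro!: SUP_least intro: INF_lower)

lemma free_frame_normal_form: "U = (SUP F\<in>Rep_free_frame U. INF g\<in>fset F. free_gen g)"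
proof -
  have *: "Rep_free_frame (INF g\<in>fset F. free_gen g) = {G. F |\<subseteq>| G}" for F :: "'a fset"
    by (auto simp: Inf_free_frame.rep_eq free_gen.rep_eq)
  show ?thesis
    unfolding Rep_free_frame_inject[symmetric]
    by (auto simp: Sup_free_frame.rep_eq * intro: Rep_free_frame_up)
qed

lemma saturation_hom: "frame_hom (\<lambda>x. Abs_real_frame (saturation real_relations x))"
proof -
  have *: "Abs_real_frame (saturation real_relations x) = y \<longleftrightarrow>
      saturation real_relations x = Rep_real_frame y" for x y
    by (metis Abs_real_frame_inverse Rep_real_frame_inverse mem_Collect_eq saturated_saturation)
  show ?thesis
  proof (rule frame_homI)
    show "Abs_real_frame (saturation real_relations top) = top"
      unfolding * by (simp add: top_real_frame.rep_eq top_le le_saturation)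
    show "Abs_real_frame (saturation real_relations (inf x y)) =
      inf (Abs_real_frame (saturation real_relations x)) (Abs_real_frame (saturation real_relations y))" for x y
      unfolding * by (simp add: inf_real_frame.rep_eq saturation_inf Abs_real_frame_inverse)
    have "saturation real_relations (Sup A) =
      saturation real_relations (SUP x\<in>A. saturation real_relations x)" for A
    proof (rule antisym)
      show "saturation real_relations (Sup A) \<le>
        saturation real_relations (SUP x\<in>A. saturation real_relations x)"
        by (intro saturation_mono Sup_least) (rule SUP_upper2, assumption, rule le_saturation)
      show "saturation real_relations (SUP x\<in>A. saturation real_relations x) \<le>
        saturation real_relations (Sup A)"
        by (intro saturation_least saturated_saturation SUP_least saturation_mono Sup_upper)
    qed
    then show "Abs_real_frame (saturation real_relations (Sup A)) =
      (SUP x\<in>A. Abs_real_frame (saturation real_relations x))" for A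
      unfolding * by (simp add: Sup_real_frame.rep_eq image_image Abs_real_frame_inverse)
  qed
qed

lemma saturation_cong:
  assumes "(a, b) \<in> R" shows "saturation R a = saturation R b"
proof -
  have "a \<le> y \<longleftrightarrow> b \<le> y" if "saturated R y" for y
  proof -
    have "inf a top \<le> y \<longleftrightarrow> inf b top \<le> y"
      using that assms unfolding saturated_def by blast
    then show ?thesis by simp
  qed
  then show ?thesis by (metis antisym saturation_least le_saturation saturated_saturation)
qed

theorem satisfies_real_relations_hom:
  assumes "frame_hom h" shows "satisfies_real_relations (\<lambda>g. h (real_gen g))"
proof -
  define k where "k = h \<circ> (\<lambda>x. Abs_real_frame (saturation real_relations x))"
  have k: "frame_hom k"
    unfolding k_def by (intro frame_hom_comp assms saturation_hom)
  have gen: "h (real_gen g) = k (free_gen g)" for g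
    by (simp add: k_def real_gen_def)
  have eq: "k a = k b" if "(a, b) \<in> real_relations" for a b
    unfolding k_def by (simp add: saturation_cong[OF that])
  show ?thesis
    unfolding satisfies_real_relations_def gen
    unfolding frame_hom_inf[OF k, symmetric] frame_hom_sup[OF k, symmetric]
      frame_hom_SUP[OF k, symmetric] frame_hom_top[OF k, symmetric] frame_hom_bot[OF k, symmetric]
    by (intro conjI allI impI; rule eq; unfold real_relations_def Let_def; blast)
qed

lemma saturation_lift:
  assumes k: "frame_hom k" and R: "\<And>a b. (a, b) \<in> R \<Longrightarrow> k a = k b"
  shows "k (saturation R x) = k x"
proof (rule antisym)
  define t where "t = Sup {z. k z \<le> k x}"
  have t: "z \<le> t \<longleftrightarrow> k z \<le> k x" for z
  proof
    assume "z \<le> t"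
    then have "k z \<le> k t" by (rule frame_hom_mono[OF k])
    also have "k t \<le> k x" unfolding t_def frame_hom_Sup[OF k] by (auto intro: SUP_least)
    finally show "k z \<le> k x" .
  qed (auto simp: t_def intro: Sup_upper)
  have "saturated R t"
    unfolding saturated_def t frame_hom_inf[OF k] using R by fastforce
  then have "saturation R x \<le> t" by (rule saturation_least) (simp add: t)
  then show "k (saturation R x) \<le> k x" by (simp add: t)
qed (intro frame_hom_mono[OF k] le_saturation)

theorem real_frame_universal:
  fixes \<phi> :: "real_generator \<Rightarrow> 'a::frame"
  assumes "satisfies_real_relations \<phi>"
  shows "\<exists>!h. frame_hom h \<and> (\<forall>g. h (real_gen g) = \<phi> g)"
proof (rule ex1I)
  let ?k = "free_lift \<phi>"
  note k = free_lift_hom[of \<phi>]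
  have R: "?k a = ?k b" if "(a, b) \<in> real_relations" for a b
  proof -
    note r = assms[unfolded satisfies_real_relations_def]
    note s = r[THEN conjunct1] r[THEN conjunct2, THEN conjunct1]
      r[THEN conjunct2, THEN conjunct2, THEN conjunct1, THEN spec, symmetric]
      r[THEN conjunct2, THEN conjunct2, THEN conjunct2, THEN conjunct1, THEN spec, symmetric]
      r[THEN conjunct2, THEN conjunct2, THEN conjunct2, THEN conjunct2]
    show ?thesis
      using that unfolding real_relations_def Let_def
      by (auto simp: s free_lift_gen frame_hom_inf[OF k] frame_hom_sup[OF k] frame_hom_SUP[OF k]
          frame_hom_top[OF k] frame_hom_bot[OF k])
  qed
  note sat = saturation_lift[OF k R]
  show "frame_hom (\<lambda>x. ?k (Rep_real_frame x)) \<and> (\<forall>g. ?k (Rep_real_frame (real_gen g)) = \<phi> g)"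
  proof (intro conjI allI frame_homI)
    show "?k (Rep_real_frame (real_gen g)) = \<phi> g" for g
      by (simp add: real_gen.rep_eq sat free_lift_gen)
    show "?k (Rep_real_frame top) = top"
      by (simp add: top_real_frame.rep_eq frame_hom_top[OF k])
    show "?k (Rep_real_frame (inf x y)) = inf (?k (Rep_real_frame x)) (?k (Rep_real_frame y))" for x y
      by (simp add: inf_real_frame.rep_eq frame_hom_inf[OF k])
    show "?k (Rep_real_frame (Sup A)) = (SUP x\<in>A. ?k (Rep_real_frame x))" for A
      by (simp add: Sup_real_frame.rep_eq sat frame_hom_SUP[OF k])
  qed
next
  fix h assume h: "frame_hom h \<and> (\<forall>g. h (real_gen g) = \<phi> g)"
  let ?s = "\<lambda>x. Abs_real_frame (saturation real_relations x)"
  have hs: "frame_hom (h \<circ> ?s)"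
    using h by (intro frame_hom_comp saturation_hom) simp
  have gen: "(h \<circ> ?s) (free_gen g) = \<phi> g" for g
    using h by (simp add: real_gen_def)
  have *: "(h \<circ> ?s) U = free_lift \<phi> U" for U
  proof -
    have "(h \<circ> ?s) U = (h \<circ> ?s) (SUP F\<in>Rep_free_frame U. INF g\<in>fset F. free_gen g)"
      by (subst free_frame_normal_form[of U]) (rule refl)
    also have "\<dots> = free_lift \<phi> U"
      unfolding frame_hom_SUP[OF hs] frame_hom_INF_fset[OF hs] gen free_lift_def ..
    finally show ?thesis .
  qed
  show "h = (\<lambda>x. free_lift \<phi> (Rep_real_frame x))"
  proof
    fix x
    have "?s (Rep_real_frame x) = x"
      using Rep_real_frame[of x] by (simp add: saturation_id Rep_real_frame_inverse)
    then show "h x = free_lift \<phi> (Rep_real_frame x)" using *[of "Rep_real_frame x"] by simp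
  qed
qed


section \<open>Riesz spaces\<close>

record 'a riesz = "'a gorder" +
  add :: "'a \<Rightarrow> 'a \<Rightarrow> 'a" (infixl \<open>\<oplus>\<index>\<close> 65)
  zero :: 'a (\<open>\<zero>\<index>\<close>)
  scale :: "real \<Rightarrow> 'a \<Rightarrow> 'a" (infixr \<open>\<odot>\<index>\<close> 75)

locale riesz_space = lattice R for R :: "('a, 'm) riesz_scheme" (structure) +
  assumes add_group: "comm_group \<lparr>carrier = carrier R, monoid.mult = (\<oplus>), one = \<zero>\<rparr>"
    and scale_closed: "x \<in> carrier R \<Longrightarrow> a \<odot> x \<in> carrier R"
    and scale_add_right: "x \<in> carrier R \<Longrightarrow> y \<in> carrier R \<Longrightarrow> a \<odot> (x \<oplus> y) = a \<odot> x \<oplus> a \<odot> y"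
    and scale_add_left: "x \<in> carrier R \<Longrightarrow> (a + b) \<odot> x = a \<odot> x \<oplus> b \<odot> x"
    and scale_scale: "x \<in> carrier R \<Longrightarrow> a \<odot> (b \<odot> x) = (a * b) \<odot> x"
    and scale_one: "x \<in> carrier R \<Longrightarrow> 1 \<odot> x = x"
    and add_mono: "x \<in> carrier R \<Longrightarrow> y \<in> carrier R \<Longrightarrow> z \<in> carrier R \<Longrightarrow>
      x \<sqsubseteq> y \<Longrightarrow> x \<oplus> z \<sqsubseteq> y \<oplus> z"
    and scale_nonneg: "x \<in> carrier R \<Longrightarrow> \<zero> \<sqsubseteq> x \<Longrightarrow> 0 \<le> a \<Longrightarrow> \<zero> \<sqsubseteq> a \<odot> x"

definition pos_cone :: "('a, 'm) riesz_scheme \<Rightarrow> 'a set" where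
  "pos_cone R = {x \<in> carrier R. \<zero>\<^bsub>R\<^esub> \<sqsubseteq>\<^bsub>R\<^esub> x}"

definition is_supremum :: "('a, 'm) riesz_scheme \<Rightarrow> 'a set \<Rightarrow> 'a \<Rightarrow> bool" where
  "is_supremum R A s \<longleftrightarrow> least R s (Upper R A)"

definition dedekind_complete :: "('a, 'm) riesz_scheme \<Rightarrow> bool" where
  "dedekind_complete R \<longleftrightarrow>
     (\<forall>A \<subseteq> carrier R. A \<noteq> {} \<longrightarrow> Upper R A \<noteq> {} \<longrightarrow> (\<exists>s. is_supremum R A s))"

definition laterally_complete :: "('a, 'm) riesz_scheme \<Rightarrow> bool" where
  "laterally_complete R \<longleftrightarrow>
     (\<forall>A \<subseteq> pos_cone R. A \<noteq> {} \<longrightarrow> pairwise (\<lambda>g h. g \<sqinter>\<^bsub>R\<^esub> h = \<zero>\<^bsub>R\<^esub>) A \<longrightarrow> (\<exists>s. is_supremum R A s))"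

definition universally_complete :: "('a, 'm) riesz_scheme \<Rightarrow> bool" where
  "universally_complete R \<longleftrightarrow> dedekind_complete R \<and> laterally_complete R"

locale riesz_embedding = R: riesz_space R + S: riesz_space S
  for R :: "('a, 'm) riesz_scheme" and S :: "('b, 'n) riesz_scheme" and \<mu> :: "'a \<Rightarrow> 'b" +
  assumes maps: "\<mu> \<in> carrier R \<rightarrow> carrier S"
    and map_add: "x \<in> carrier R \<Longrightarrow> y \<in> carrier R \<Longrightarrow> \<mu> (x \<oplus>\<^bsub>R\<^esub> y) = \<mu> x \<oplus>\<^bsub>S\<^esub> \<mu> y"
    and map_scale: "x \<in> carrier R \<Longrightarrow> \<mu> (a \<odot>\<^bsub>R\<^esub> x) = a \<odot>\<^bsub>S\<^esub> \<mu> x"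
    and map_join: "x \<in> carrier R \<Longrightarrow> y \<in> carrier R \<Longrightarrow> \<mu> (x \<squnion>\<^bsub>R\<^esub> y) = \<mu> x \<squnion>\<^bsub>S\<^esub> \<mu> y"
    and map_meet: "x \<in> carrier R \<Longrightarrow> y \<in> carrier R \<Longrightarrow> \<mu> (x \<sqinter>\<^bsub>R\<^esub> y) = \<mu> x \<sqinter>\<^bsub>S\<^esub> \<mu> y"
    and injective: "inj_on \<mu> (carrier R)"

locale universal_completion = riesz_embedding R U \<mu>
  for R :: "('a, 'm) riesz_scheme" and U :: "('b, 'n) riesz_scheme" and \<mu> :: "'a \<Rightarrow> 'b" +
  assumes complete: "universally_complete U"
    and approximation: "f \<in> pos_cone U \<Longrightarrow>
      is_supremum U {\<mu> g | g. g \<in> carrier R \<and> \<zero>\<^bsub>U\<^esub> \<sqsubseteq>\<^bsub>U\<^esub> \<mu> g \<and> \<mu> g \<sqsubseteq>\<^bsub>U\<^esub> f} f"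


section \<open>Continuous real functions on a frame\<close>

text \<open>Meaningful only if \<open>\<phi>\<close> satisfies the relations of the presentation.\<close>

definition extend :: "(real_generator \<Rightarrow> 'a::frame) \<Rightarrow> real_frame \<Rightarrow> 'a" where
  "extend \<phi> = (THE h. frame_hom h \<and> (\<forall>g. h (real_gen g) = \<phi> g))"

definition cont_const :: "rat \<Rightarrow> real_frame \<Rightarrow> 'a::frame" where
  "cont_const r = extend (\<lambda>x. case x of
     Above p \<Rightarrow> if p < r then top else bot
   | Below q \<Rightarrow> if r < q then top else bot)"

definition cont_add :: "(real_frame \<Rightarrow> 'a::frame) \<Rightarrow> (real_frame \<Rightarrow> 'a) \<Rightarrow> real_frame \<Rightarrow> 'a" where
  "cont_add f g = extend (\<lambda>x. case x of
     Above p \<Rightarrow> SUP r. inf (f (above r)) (g (above (p - r)))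
   | Below q \<Rightarrow> SUP s. inf (f (below s)) (g (below (q - s))))"

definition cont_uminus :: "(real_frame \<Rightarrow> 'a::frame) \<Rightarrow> real_frame \<Rightarrow> 'a" where
  "cont_uminus f = extend (\<lambda>x. case x of Above p \<Rightarrow> f (below (- p)) | Below q \<Rightarrow> f (above (- q)))"

definition cont_scale_pos :: "real \<Rightarrow> (real_frame \<Rightarrow> 'a::frame) \<Rightarrow> real_frame \<Rightarrow> 'a" where
  "cont_scale_pos c f = extend (\<lambda>x. case x of
     Above p \<Rightarrow> SUP r\<in>{r. of_rat p < c * of_rat r}. f (above r)
   | Below q \<Rightarrow> SUP s\<in>{s. c * of_rat s < of_rat q}. f (below s))"

definition cont_scale :: "real \<Rightarrow> (real_frame \<Rightarrow> 'a::frame) \<Rightarrow> real_frame \<Rightarrow> 'a" where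
  "cont_scale c f =
     (if 0 < c then cont_scale_pos c f
      else if c = 0 then cont_const 0
      else cont_uminus (cont_scale_pos (- c) f))"

definition cont_real :: "'a::frame itself \<Rightarrow> (real_frame \<Rightarrow> 'a) riesz" where
  "cont_real _ = \<lparr>carrier = {f. frame_hom f}, eq = (=),
     le = (\<lambda>f g. \<forall>p. f (above p) \<le> g (above p)),
     add = cont_add, zero = cont_const 0, scale = cont_scale\<rparr>"

end

theory Submission
  imports Defs
begin

text \<open>
  A homomorphism \<open>f\<close> on the frame of reals is determined by the antitone family \<open>f (p,-)\<close>, and every
  family whose members are rather below the earlier ones, with joins of members and of pseudocomplements
  both equal to 1, induces one. So the Riesz space laws become inequalities between joins over the
  rationals; that a sum satisfies \<open>(p,-) \<or> (-,q) = 1\<close>, and that \<open>f + (-f) = 0\<close>, uses that the images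
  of the intervals of a fixed length cover.

  In a Boolean frame \<open>\<le>\<close> and \<open>\<prec>\<close> coincide, so pointwise suprema are continuous functions as soon as
  they are finite, which gives Dedekind and lateral completeness. The map \<open>\<beta>\<close> preserves the Riesz
  operations because they are expressed by joins and finite meets, and it is injective on functions
  because \<open>b \<prec> a\<close> implies \<open>b\<^sup>*\<^sup>* \<le> a\<close>. Finally \<open>h (q,-)\<close> is a join of elements \<open>b\<close> completely below
  it in \<open>L\<close>; for \<open>q > 0\<close> a Urysohn function with values in \<open>[0, q]\<close> that is \<open>q\<close> on \<open>b\<close> and vanishes
  off \<open>h (q,-)\<close> lies below \<open>h\<close>.
\<close>

section \<open>Frames and continuous real functions\<close>

\<comment> \<open>The frame law for two-element joins is one distributive law, and in a lattice it
  implies the other; the facts on distributive lattices become available.\<close>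
subclass (in frame) distrib_lattice
proof
  fix x y z :: 'a
  have *: "inf a (sup b c) = sup (inf a b) (inf a c)" for a b c :: 'a
    using inf_Sup_frame[of a "{b, c}"] by simp
  show "sup x (inf y z) = inf (sup x y) (sup x z)"
    by (rule distrib_imp1[OF *])
qed

lemma rather_below_le: "rather_below b a \<Longrightarrow> b \<le> a"
proof -
  assume "rather_below b a"
  then have "b = inf b (sup (pseudocomplement b) a)"
    by (simp add: rather_below_def)
  also have "\<dots> = inf b a" by (simp add: inf_sup_distrib1)
  finally show ?thesis by (simp add: inf.absorb_iff1)
qed

lemma pseudocomplement_bot [simp]: "pseudocomplement bot = (top :: 'a::frame)"
  by (simp add: top_unique[symmetric] le_pseudocomplement)

text \<open>By distributivity \<open>x\<close> is the join of its parts under the members of a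
  cover. This replaces the case distinction of a pointwise argument.\<close>

lemma le_of_inf_le_of_sup_eq_top:
  fixes x :: "'a::frame"
  assumes "sup a b = top" "inf x a \<le> y" "inf x b \<le> y"
  shows "x \<le> y"
proof -
  have "x = sup (inf x a) (inf x b)"
    using assms(1) by (simp add: inf_sup_distrib1[symmetric])
  with assms show ?thesis by (metis sup_least)
qed

text \<open>The frame law splits \<open>x\<close> along an infinite cover in the same way;
  pointwise, this is the choice of a suitable index.\<close>

lemma le_of_inf_le_of_SUP_eq_top:
  fixes x :: "'a::frame"
  assumes "(SUP i. a i) = top" "\<And>i. inf x (a i) \<le> y"
  shows "x \<le> y"
proof -
  have "x = (SUP i. inf x (a i))"
    using assms(1) by (simp add: inf_SUP_frame[symmetric])
  with assms(2) show ?thesis by (metis SUP_least)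
qed

text \<open>The frame law yields meets \<open>inf (a i) (b j)\<close> over all pairs. Antitonicity
  bounds each by the diagonal meet at \<open>min i j\<close>.\<close>

lemma SUP_inf_antimono_eq_top:
  fixes a b :: "'i::linorder \<Rightarrow> 'a::frame"
  assumes "antimono a" "antimono b" "(SUP i. a i) = top" "(SUP i. b i) = top"
  shows "(SUP i. inf (a i) (b i)) = top"
proof (rule top_le)
  have "inf (a i) (b j) \<le> (SUP i. inf (a i) (b i))" for i j
    by (rule SUP_upper2[of "min i j"], simp)
      (intro inf_mono antimonoD[OF assms(1)] antimonoD[OF assms(2)]; simp)
  then have "inf top (a i) \<le> (SUP i. inf (a i) (b i))" for i
    unfolding inf_top_left by (rule le_of_inf_le_of_SUP_eq_top[OF assms(4)])
  then show "top \<le> (SUP i. inf (a i) (b i))"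
    by (rule le_of_inf_le_of_SUP_eq_top[OF assms(3)])
qed

lemma SUP_inf_mono_eq_top:
  fixes a b :: "'i::linorder \<Rightarrow> 'a::frame"
  assumes "mono a" "mono b" "(SUP i. a i) = top" "(SUP i. b i) = top"
  shows "(SUP i. inf (a i) (b i)) = top"
proof (rule top_le)
  have "inf (a i) (b j) \<le> (SUP i. inf (a i) (b i))" for i j
    by (rule SUP_upper2[of "max i j"], simp)
      (intro inf_mono monoD[OF assms(1)] monoD[OF assms(2)]; simp)
  then have "inf top (a i) \<le> (SUP i. inf (a i) (b i))" for i
    unfolding inf_top_left by (rule le_of_inf_le_of_SUP_eq_top[OF assms(4)])
  then show "top \<le> (SUP i. inf (a i) (b i))"
    by (rule le_of_inf_le_of_SUP_eq_top[OF assms(3)])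
qed

section \<open>Homomorphisms on the frame of reals\<close>

lemma frame_hom_extend:
  assumes "satisfies_real_relations \<phi>"
  shows "frame_hom (extend \<phi>)" and "extend \<phi> (real_gen g) = \<phi> g"
  using theI'[OF real_frame_universal[OF assms]] unfolding extend_def by blast+

text \<open>Relations (r3) and (r4) are equalities; for monotone families only one inequality of
  each has content, namely \<open>a_le\<close> and \<open>b_le\<close>.\<close>

lemma satisfies_real_relationsI:
  fixes a b :: "rat \<Rightarrow> 'a::frame"
  assumes disjoint: "\<And>p q. q \<le> p \<Longrightarrow> inf (a p) (b q) = bot"
    and cover: "\<And>p q. p < q \<Longrightarrow> sup (a p) (b q) = top"
    and a_mono: "\<And>p q. p < q \<Longrightarrow> a q \<le> a p"
    and a_le: "\<And>p. a p \<le> (SUP q\<in>{q. p < q}. a q)"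
    and b_mono: "\<And>p q. p < q \<Longrightarrow> b p \<le> b q"
    and b_le: "\<And>p. b p \<le> (SUP q\<in>{q. q < p}. b q)"
    and "(SUP p. a p) = top" "(SUP p. b p) = top"
  shows "satisfies_real_relations (\<lambda>x. case x of Above p \<Rightarrow> a p | Below q \<Rightarrow> b q)"
proof -
  have "a p = (SUP q\<in>{q. p < q}. a q)" for p
    by (intro antisym a_le SUP_least) (simp add: a_mono)
  moreover have "b p = (SUP q\<in>{q. q < p}. b q)" for p
    by (intro antisym b_le SUP_least) (simp add: b_mono)
  ultimately show ?thesis
    unfolding satisfies_real_relations_def real_generator.case
    using disjoint cover assms(7,8) by blast
qed

context
  fixes f :: "real_frame \<Rightarrow> 'a::frame"
  assumes f: "frame_hom f"
begin

lemma hom_above_below_disjoint: "q \<le> p \<Longrightarrow> inf (f (above p)) (f (below q)) = bot"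
  and hom_above_below_cover: "p < q \<Longrightarrow> sup (f (above p)) (f (below q)) = top"
  and hom_above_SUP: "f (above p) = (SUP q\<in>{q. p < q}. f (above q))"
  and hom_below_SUP: "f (below p) = (SUP q\<in>{q. q < p}. f (below q))"
  and hom_SUP_above: "(SUP p. f (above p)) = top"
  and hom_SUP_below: "(SUP p. f (below p)) = top"
  using satisfies_real_relations_hom[OF f] unfolding satisfies_real_relations_def by blast+

lemma hom_above_antimono: "p \<le> q \<Longrightarrow> f (above q) \<le> f (above p)"
  by (cases "p = q") (auto simp: hom_above_SUP[of p] intro: SUP_upper)

lemma hom_below_mono: "p \<le> q \<Longrightarrow> f (below p) \<le> f (below q)"
  by (cases "p = q") (auto simp: hom_below_SUP[of q] intro: SUP_upper)

lemma antimono_hom_above: "antimono (\<lambda>p. f (above p))"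
  by (simp add: antimonoI hom_above_antimono)

text \<open>Disjointness puts \<open>f (below p)\<close> under the pseudocomplement of
  \<open>f (above p)\<close>, and the cover for \<open>p < q\<close> puts that under
  \<open>f (below q)\<close>. Hence the values on \<open>above\<close> determine those on
  \<open>below\<close>.\<close>

lemma hom_below_eq_SUP_pseudocomplement:
  "f (below q) = (SUP p\<in>{p. p < q}. pseudocomplement (f (above p)))"
proof (rule antisym)
  have "f (below p) \<le> pseudocomplement (f (above p))" for p
    by (simp add: le_pseudocomplement hom_above_below_disjoint)
  then show "f (below q) \<le> (SUP p\<in>{p. p < q}. pseudocomplement (f (above p)))"
    by (subst hom_below_SUP) (blast intro: SUP_mono)
  have "pseudocomplement (f (above p)) \<le> f (below q)" if "p < q" for p
    by (rule le_of_inf_le_of_sup_eq_top[OF hom_above_below_cover[OF that]])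
      (simp_all add: inf_commute)
  then show "(SUP p\<in>{p. p < q}. pseudocomplement (f (above p))) \<le> f (below q)"
    by (auto intro: SUP_least)
qed

text \<open>For \<open>r\<close> strictly between \<open>p\<close> and \<open>q\<close>,
  \<open>f (below r)\<close> is disjoint from \<open>f (above q)\<close> and together with
  \<open>f (above p)\<close> covers.\<close>

lemma hom_above_rather_below: "p < q \<Longrightarrow> rather_below (f (above q)) (f (above p))"
proof -
  assume "p < q"
  then obtain r where r: "p < r" "r < q" using dense by blast
  have "f (below r) \<le> pseudocomplement (f (above q))"
    using r by (simp add: le_pseudocomplement hom_above_below_disjoint)
  then have "sup (f (above p)) (f (below r)) \<le> sup (pseudocomplement (f (above q))) (f (above p))"
    by (simp add: le_supI1)
  then show ?thesis
    using hom_above_below_cover[OF r(1)] by (simp add: rather_below_def top_unique)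
qed

lemma hom_SUP_pseudocomplement_above: "(SUP p. pseudocomplement (f (above p))) = top"
proof (rule top_le)
  have "f (below q) \<le> (SUP p. pseudocomplement (f (above p)))" for q
    unfolding hom_below_eq_SUP_pseudocomplement by (rule SUP_subset_mono) auto
  then show "top \<le> (SUP p. pseudocomplement (f (above p)))"
    unfolding hom_SUP_below[symmetric] by (rule SUP_least)
qed

text \<open>Every bounded interval is covered by finitely many overlapping intervals of length
  \<open>\<epsilon>\<close>, each shifted by half that length. Sums need this cover because the
  value of \<open>f\<close> must be located up to an error before \<open>g\<close> can be compared
  with what is left.\<close>

lemma hom_narrow_cover:
  assumes "0 < \<epsilon>"
  shows "(SUP r. inf (f (above r)) (f (below (r + \<epsilon>)))) = top" (is "?x = _")
proof (rule top_le)
  define \<delta> where "\<delta> = \<epsilon> / 2"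
  have \<delta>: "0 < \<delta>" "\<epsilon> = 2 * \<delta>" using assms by (simp_all add: \<delta>_def)
  have *: "inf (f (above p)) (f (below (p + of_nat n * \<delta>))) \<le> ?x" for p n
  proof (induction n)
    case 0
    show ?case by (simp add: hom_above_below_disjoint)
  next
    case (Suc n)
    \<comment> \<open>This is the left end of the interval of length \<open>\<epsilon>\<close> that
      reaches the new right end. It lies \<open>\<delta>\<close> to the left of the old right end,
      so the two pieces overlap and \<open>cover\<close> applies.\<close>
    let ?r = "p + (of_nat n - 1) * \<delta>"
    have "?r < p + of_nat n * \<delta>" using \<delta>(1) by (simp add: algebra_simps)
    note cover = hom_above_below_cover[OF this]
    have eq: "p + of_nat (Suc n) * \<delta> = ?r + \<epsilon>" by (simp add: \<delta>(2) algebra_simps)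
    show ?case
    proof (rule le_of_inf_le_of_sup_eq_top[OF cover])
      have "inf (f (above ?r)) (f (below (?r + \<epsilon>))) \<le> ?x"
        by (rule SUP_upper2[of ?r]) simp_all
      then show "inf (inf (f (above p)) (f (below (p + of_nat (Suc n) * \<delta>)))) (f (above ?r)) \<le> ?x"
        unfolding eq by (rule order_trans[rotated]) (simp add: le_infI1 le_infI2)
      show "inf (inf (f (above p)) (f (below (p + of_nat (Suc n) * \<delta>))))
          (f (below (p + of_nat n * \<delta>))) \<le> ?x"
        by (rule order_trans[OF _ Suc]) (simp add: le_infI1)
    qed
  qed
  have "inf (f (above p)) (f (below q)) \<le> ?x" for p q
  proof -
    \<comment> \<open>Finitely many steps of size \<open>\<delta>\<close> reach \<open>q\<close>;
      the bounds \<open>p\<close> and \<open>q\<close> are then removed by (r5) and (r6).\<close>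
    obtain n where "(q - p) / \<delta> < of_nat n" using reals_Archimedean2 by blast
    then have "q \<le> p + of_nat n * \<delta>" using \<delta>(1) by (simp add: field_simps)
    then have "inf (f (above p)) (f (below q)) \<le> inf (f (above p)) (f (below (p + of_nat n * \<delta>)))"
      by (intro inf_mono hom_below_mono) simp_all
    with * show ?thesis by (rule order_trans[rotated])
  qed
  then have "inf top (f (above p)) \<le> ?x" for p
    unfolding inf_top_left by (rule le_of_inf_le_of_SUP_eq_top[OF hom_SUP_below])
  then show "top \<le> ?x"
    by (rule le_of_inf_le_of_SUP_eq_top[OF hom_SUP_above])
qed

end

text \<open>The values on \<open>above\<close> fix those on \<open>below\<close>, and the universal
  property makes a homomorphism unique given its values on generators.\<close>

lemma hom_eqI:
  assumes "frame_hom f" "frame_hom g" "\<And>p. f (above p) = g (above p)"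
  shows "f = g"
proof -
  have "f (real_gen x) = g (real_gen x)" for x
    using assms(3) hom_below_eq_SUP_pseudocomplement[OF assms(1)]
      hom_below_eq_SUP_pseudocomplement[OF assms(2)] by (cases x) simp_all
  with assms(1,2) show ?thesis
    using ex1E[OF real_frame_universal[OF satisfies_real_relations_hom[OF assms(2)]]] by blast
qed


section \<open>The operations\<close>

text \<open>The family \<open>c\<close> need not satisfy (r3), so it is replaced by the joins over
  larger indices; the values on \<open>below\<close> are the corresponding joins of
  pseudocomplements. For \<open>p < s < t < q\<close>, \<open>c t\<close> rather below
  \<open>c s\<close> is exactly the cover that (r2) requires.\<close>

lemma hom_of_scale:
  fixes c :: "rat \<Rightarrow> 'a::frame"
  assumes c: "\<And>s t. s < t \<Longrightarrow> rather_below (c t) (c s)"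
    and "(SUP s. c s) = top" "(SUP s. pseudocomplement (c s)) = top"
  obtains f where "frame_hom f" "\<And>p. f (above p) = (SUP s\<in>{s. p < s}. c s)"
proof
  let ?a = "\<lambda>p. SUP s\<in>{s. p < s}. c s"
  let ?b = "\<lambda>q. SUP s\<in>{s. s < q}. pseudocomplement (c s)"
  have sat: "satisfies_real_relations (\<lambda>x. case x of Above p \<Rightarrow> ?a p | Below q \<Rightarrow> ?b q)"
  proof (rule satisfies_real_relationsI)
    fix p q :: rat
    show "inf (?a p) (?b q) = bot" if "q \<le> p"
    proof -
      have "inf (c s) (pseudocomplement (c t)) \<le> bot" if "p < s" "t < q" for s t
      proof -
        have "inf (c s) (pseudocomplement (c t)) \<le> inf (c t) (pseudocomplement (c t))"
          using that \<open>q \<le> p\<close> rather_below_le[OF c, of t s] by (intro inf_mono) simp_all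
        then show ?thesis by simp
      qed
      then have "inf (?a p) (?b q) \<le> bot"
        by (simp only: SUP_inf_SUP_frame SUP_le_iff mem_Collect_eq Ball_def) blast
      then show ?thesis by (simp only: bot_unique)
    qed
    show "sup (?a p) (?b q) = top" if "p < q"
    proof -
      obtain s where s: "p < s" "s < q" using dense[OF \<open>p < q\<close>] by blast
      obtain t where t: "s < t" "t < q" using dense[OF s(2)] by blast
      have "top = sup (c s) (pseudocomplement (c t))"
        using c[OF t(1)] by (simp add: rather_below_def sup_commute)
      also have "\<dots> \<le> sup (?a p) (?b q)"
        using s t by (intro sup_mono SUP_upper) simp_all
      finally show ?thesis by (simp add: top_unique)
    qed
    show "?a q \<le> ?a p" "?b p \<le> ?b q" if "p < q"
      using that by (intro SUP_subset_mono; auto)+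
    have "c s \<le> (SUP q\<in>{q. p < q}. ?a q)" if "p < s" for s
    proof -
      obtain q where "p < q" "q < s" using dense[OF \<open>p < s\<close>] by blast
      then show ?thesis by (auto intro!: SUP_upper2[of q] SUP_upper)
    qed
    then show "?a p \<le> (SUP q\<in>{q. p < q}. ?a q)" by (auto intro: SUP_least)
    have "pseudocomplement (c s) \<le> (SUP q\<in>{q. q < p}. ?b q)" if "s < p" for s
    proof -
      obtain q where "s < q" "q < p" using dense[OF \<open>s < p\<close>] by blast
      then show ?thesis by (auto intro!: SUP_upper2[of q] SUP_upper)
    qed
    then show "?b p \<le> (SUP q\<in>{q. q < p}. ?b q)" by (auto intro: SUP_least)
  next
    have "c s \<le> (SUP p. ?a p)" for s
      by (rule SUP_upper2[of "s - 1"]) (auto intro: SUP_upper)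
    then show "(SUP p. ?a p) = top"
      using assms(2) by (metis SUP_least top_le)
    have "pseudocomplement (c s) \<le> (SUP p. ?b p)" for s
      by (rule SUP_upper2[of "s + 1"]) (auto intro: SUP_upper)
    then show "(SUP p. ?b p) = top"
      using assms(3) by (metis SUP_least top_le)
  qed
  show "frame_hom (extend (\<lambda>x. case x of Above p \<Rightarrow> ?a p | Below q \<Rightarrow> ?b q))"
    "\<And>p. extend (\<lambda>x. case x of Above p \<Rightarrow> ?a p | Below q \<Rightarrow> ?b q) (above p) = ?a p"
    by (simp_all add: frame_hom_extend[OF sat])
qed

section \<open>Constants, negation, sums and positive multiples\<close>

lemma
  shows frame_hom_const: "frame_hom (cont_const r :: _ \<Rightarrow> 'a::frame)"
    and const_above: "cont_const r (above p) = (if p < r then top else bot :: 'a)"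
    and const_below: "cont_const r (below p) = (if r < p then top else bot :: 'a)"
proof -
  have sat: "satisfies_real_relations (\<lambda>x. case x of
      Above p \<Rightarrow> if p < r then top else (bot :: 'a) | Below q \<Rightarrow> if r < q then top else bot)"
  proof (rule satisfies_real_relationsI)
    fix p :: rat
    show "(if p < r then top else (bot :: 'a)) \<le> (SUP q\<in>{q. p < q}. if q < r then top else bot)"
    proof (cases "p < r")
      case True
      then obtain q where "p < q" "q < r" using dense by blast
      then show ?thesis by (intro SUP_upper2[of q]) simp_all
    qed simp
    show "(if r < p then top else (bot :: 'a)) \<le> (SUP q\<in>{q. q < p}. if r < q then top else bot)"
    proof (cases "r < p")
      case True
      then obtain q where "r < q" "q < p" using dense by blast
      then show ?thesis by (intro SUP_upper2[of q]) simp_all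
    qed simp
    show "(SUP p. if p < r then top else (bot :: 'a)) = top"
      by (rule top_le[OF SUP_upper2[of "r - 1"]]) simp_all
    show "(SUP p. if r < p then top else (bot :: 'a)) = top"
      by (rule top_le[OF SUP_upper2[of "r + 1"]]) simp_all
  qed auto
  show "frame_hom (cont_const r :: _ \<Rightarrow> 'a::frame)"
    "cont_const r (above p) = (if p < r then top else bot :: 'a)"
    "cont_const r (below p) = (if r < p then top else bot :: 'a)"
    unfolding cont_const_def by (simp_all add: frame_hom_extend[OF sat])
qed

lemma
  assumes f: "frame_hom (f :: _ \<Rightarrow> 'a::frame)"
  shows frame_hom_uminus: "frame_hom (cont_uminus f)"
    and uminus_above: "cont_uminus f (above p) = f (below (- p))"
    and uminus_below: "cont_uminus f (below p) = f (above (- p))"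
proof -
  have sat: "satisfies_real_relations (\<lambda>x. case x of
      Above p \<Rightarrow> f (below (- p)) | Below q \<Rightarrow> f (above (- q)))"
  proof (rule satisfies_real_relationsI)
    fix p :: rat
    have "f (below q) \<le> (SUP q\<in>{q. p < q}. f (below (- q)))" if "q < - p" for q
      using that by (intro SUP_upper2[of "- q"]) simp_all
    then show "f (below (- p)) \<le> (SUP q\<in>{q. p < q}. f (below (- q)))"
      by (subst hom_below_SUP[OF f]) (blast intro: SUP_least)
    have "f (above q) \<le> (SUP q\<in>{q. q < p}. f (above (- q)))" if "- p < q" for q
      using that by (intro SUP_upper2[of "- q"]) simp_all
    then show "f (above (- p)) \<le> (SUP q\<in>{q. q < p}. f (above (- q)))"
      by (subst hom_above_SUP[OF f]) (blast intro: SUP_least)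
    have "f (below p) \<le> (SUP p. f (below (- p)))" for p
      by (rule SUP_upper2[of "- p"]) simp_all
    then show "(SUP p. f (below (- p))) = top"
      using hom_SUP_below[OF f] by (metis SUP_least top_le)
    have "f (above p) \<le> (SUP p. f (above (- p)))" for p
      by (rule SUP_upper2[of "- p"]) simp_all
    then show "(SUP p. f (above (- p))) = top"
      using hom_SUP_above[OF f] by (metis SUP_least top_le)
    fix q :: rat
    show "inf (f (below (- p))) (f (above (- q))) = bot" if "q \<le> p"
      using that by (subst inf_commute) (simp add: hom_above_below_disjoint[OF f])
    show "sup (f (below (- p))) (f (above (- q))) = top" if "p < q"
      using that by (subst sup_commute) (simp add: hom_above_below_cover[OF f])
    show "f (below (- q)) \<le> f (below (- p))" "f (above (- p)) \<le> f (above (- q))" if "p < q"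
      using that by (simp_all add: hom_above_antimono[OF f] hom_below_mono[OF f])
  qed
  show "frame_hom (cont_uminus f)" "cont_uminus f (above p) = f (below (- p))"
    "cont_uminus f (below p) = f (above (- p))"
    unfolding cont_uminus_def by (simp_all add: frame_hom_extend[OF sat])
qed

context
  fixes f g :: "real_frame \<Rightarrow> 'a::frame"
  assumes f: "frame_hom f" and g: "frame_hom g"
begin

lemma
  shows frame_hom_add: "frame_hom (cont_add f g)"
    and add_above: "cont_add f g (above p) = (SUP r. inf (f (above r)) (g (above (p - r))))"
    and add_below: "cont_add f g (below p) = (SUP r. inf (f (below r)) (g (below (p - r))))"
proof -
  define a where "a p = (SUP r. inf (f (above r)) (g (above (p - r))))" for p
  define b where "b q = (SUP s. inf (f (below s)) (g (below (q - s))))" for q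
  have a_ge: "inf (f (above r)) (g (above s)) \<le> a (r + s)" for r s
    unfolding a_def by (rule SUP_upper2[of r]) simp_all
  have b_ge: "inf (f (below r)) (g (below s)) \<le> b (r + s)" for r s
    unfolding b_def by (rule SUP_upper2[of r]) simp_all
  have sat: "satisfies_real_relations (\<lambda>x. case x of Above p \<Rightarrow> a p | Below q \<Rightarrow> b q)"
  proof (rule satisfies_real_relationsI)
    fix p q :: rat
    show "inf (a p) (b q) = bot" if "q \<le> p"
    proof -
      \<comment> \<open>At least one of \<open>s \<le> r\<close> and
        \<open>q - s \<le> p - r\<close> holds, so one of the two summands already gives the bottom
        element.\<close>
      have *: "inf (inf (f (above r)) (g (above (p - r)))) (inf (f (below s)) (g (below (q - s)))) \<le> bot"
        for r s
      proof (cases "s \<le> r")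
        case True
        show ?thesis unfolding hom_above_below_disjoint[OF f True, symmetric]
          by (intro le_infI) (simp_all add: le_infI1 le_infI2)
      next
        case False
        with \<open>q \<le> p\<close> have *: "q - s \<le> p - r" by simp
        show ?thesis unfolding hom_above_below_disjoint[OF g *, symmetric]
          by (intro le_infI) (simp_all add: le_infI1 le_infI2)
      qed
      have "inf (a p) (b q) \<le> bot"
        unfolding a_def b_def SUP_inf_SUP_frame by (intro SUP_least *)
      then show ?thesis by (simp only: bot_unique)
    qed
    show "sup (a p) (b q) = top" if "p < q"
    proof (rule top_le)
      \<comment> \<open>With half the gap, \<open>p - r < q - (r + \<epsilon>)\<close> for every
        \<open>r\<close>. So where \<open>f\<close> lies between \<open>r\<close> and
        \<open>r + \<epsilon>\<close>, the bounds left for \<open>g\<close> still cover: one part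
        falls under \<open>a p\<close>, the other under \<open>b q\<close>.\<close>
      define \<epsilon> where "\<epsilon> = (q - p) / 2"
      have \<epsilon>: "0 < \<epsilon>" "q = p + 2 * \<epsilon>" using that by (simp_all add: \<epsilon>_def field_simps)
      have "inf top (inf (f (above r)) (f (below (r + \<epsilon>)))) \<le> sup (a p) (b q)" for r
      proof -
        have *: "sup (g (above (p - r))) (g (below (q - (r + \<epsilon>)))) = top"
          using \<epsilon> by (intro hom_above_below_cover[OF g]) simp
        show ?thesis
        proof (rule le_of_inf_le_of_sup_eq_top[OF *])
          have "inf (f (above r)) (g (above (p - r))) \<le> a p"
            using a_ge[of r "p - r"] by simp
          then show "inf (inf top (inf (f (above r)) (f (below (r + \<epsilon>))))) (g (above (p - r)))
              \<le> sup (a p) (b q)"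
            by (elim le_supI1[OF order_trans[rotated]]) (simp add: le_infI1)
          have "inf (f (below (r + \<epsilon>))) (g (below (q - (r + \<epsilon>)))) \<le> b q"
            using b_ge[of "r + \<epsilon>" "q - (r + \<epsilon>)"] by simp
          then show "inf (inf top (inf (f (above r)) (f (below (r + \<epsilon>))))) (g (below (q - (r + \<epsilon>))))
              \<le> sup (a p) (b q)"
            by (elim le_supI2[OF order_trans[rotated]]) (simp add: le_infI1)
        qed
      qed
      then show "top \<le> sup (a p) (b q)"
        by (rule le_of_inf_le_of_SUP_eq_top[OF hom_narrow_cover[OF f \<epsilon>(1)]])
    qed
    show "a q \<le> a p" if "p < q"
      unfolding a_def using that
      by (intro SUP_mono' inf_mono hom_above_antimono[OF g]) simp_all
    show "b p \<le> b q" if "p < q"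
      unfolding b_def using that
      by (intro SUP_mono' inf_mono hom_below_mono[OF g]) simp_all
    have "inf (f (above r)) (g (above (p - r))) \<le> (SUP q\<in>{q. p < q}. a q)" for r
      unfolding hom_above_SUP[OF g, of "p - r"] inf_SUP_frame
    proof (rule SUP_least)
      fix t assume "t \<in> {q. p - r < q}"
      then show "inf (f (above r)) (g (above t)) \<le> (SUP q\<in>{q. p < q}. a q)"
        using a_ge[of r t] by (intro SUP_upper2[of "r + t"]) simp_all
    qed
    then show "a p \<le> (SUP q\<in>{q. p < q}. a q)"
      by (simp only: a_def[of p] SUP_le_iff) simp
    have "inf (f (below r)) (g (below (p - r))) \<le> (SUP q\<in>{q. q < p}. b q)" for r
      unfolding hom_below_SUP[OF g, of "p - r"] inf_SUP_frame
    proof (rule SUP_least)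
      fix t assume "t \<in> {q. q < p - r}"
      then show "inf (f (below r)) (g (below t)) \<le> (SUP q\<in>{q. q < p}. b q)"
        using b_ge[of r t] by (intro SUP_upper2[of "r + t"]) simp_all
    qed
    then show "b p \<le> (SUP q\<in>{q. q < p}. b q)"
      by (simp only: b_def[of p] SUP_le_iff) simp
  next
    have "inf (f (above r)) (g (above s)) \<le> (SUP p. a p)" for r s
      by (rule SUP_upper2[of "r + s"]) (simp_all add: a_ge)
    then have "f (above r) \<le> (SUP p. a p)" for r
      by (rule le_of_inf_le_of_SUP_eq_top[OF hom_SUP_above[OF g]])
    then show "(SUP p. a p) = top"
      unfolding hom_SUP_above[OF f, symmetric] by (intro antisym SUP_least) (simp_all add: hom_SUP_above[OF f])
    have "inf (f (below r)) (g (below s)) \<le> (SUP p. b p)" for r s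
      by (rule SUP_upper2[of "r + s"]) (simp_all add: b_ge)
    then have "f (below r) \<le> (SUP p. b p)" for r
      by (rule le_of_inf_le_of_SUP_eq_top[OF hom_SUP_below[OF g]])
    then show "(SUP p. b p) = top"
      unfolding hom_SUP_below[OF f, symmetric] by (intro antisym SUP_least) (simp_all add: hom_SUP_below[OF f])
  qed
  show "frame_hom (cont_add f g)"
    "cont_add f g (above p) = (SUP r. inf (f (above r)) (g (above (p - r))))"
    "cont_add f g (below p) = (SUP r. inf (f (below r)) (g (below (p - r))))"
    unfolding cont_add_def a_def[symmetric] b_def[symmetric]
    by (simp_all add: frame_hom_extend[OF sat])
qed

text \<open>The join in \<open>add_above\<close> has only exact splittings of \<open>p\<close>;
  allowing slack gives the form in which lower bounds for sums are proved below.\<close>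

lemma inf_above_le_add: "p \<le> r + s \<Longrightarrow> inf (f (above r)) (g (above s)) \<le> cont_add f g (above p)"
  unfolding add_above
  by (intro SUP_upper2[of r] inf_mono hom_above_antimono[OF g]) simp_all

end

text \<open>Since \<open>p / c\<close> need not be rational, the generators are indexed by real
  inequalities, and each relation follows by inserting rationals between reals.\<close>

lemma
  assumes f: "frame_hom (f :: _ \<Rightarrow> 'a::frame)" and c: "0 < c"
  shows frame_hom_scale_pos: "frame_hom (cont_scale_pos c f)"
    and scale_pos_above:
      "cont_scale_pos c f (above p) = (SUP r\<in>{r. of_rat p < c * of_rat r}. f (above r))"
    and scale_pos_below:
      "cont_scale_pos c f (below p) = (SUP r\<in>{r. c * of_rat r < of_rat p}. f (below r))"
proof -
  define a where "a p = (SUP r\<in>{r. of_rat p < c * of_rat r}. f (above r))" for p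
  define b where "b q = (SUP s\<in>{s. c * of_rat s < of_rat q}. f (below s))" for q
  have a_ge: "f (above r) \<le> a p" if "of_rat p < c * of_rat r" for p r
    unfolding a_def using that by (intro SUP_upper) simp
  have b_ge: "f (below r) \<le> b p" if "c * of_rat r < of_rat p" for p r
    unfolding b_def using that by (intro SUP_upper) simp
  have sat: "satisfies_real_relations (\<lambda>x. case x of Above p \<Rightarrow> a p | Below q \<Rightarrow> b q)"
  proof (rule satisfies_real_relationsI)
    fix p q :: rat
    show "inf (a p) (b q) = bot" if "q \<le> p"
    proof -
      have *: "inf (f (above r)) (f (below s)) \<le> bot"
        if "r \<in> {r. of_rat p < c * of_rat r}" "s \<in> {s. c * of_rat s < of_rat q}" for r s
      proof -
        have "c * of_rat s < of_rat q" "of_rat p < c * of_rat r" using that by simp_all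
        moreover have "(of_rat q :: real) \<le> of_rat p" using \<open>q \<le> p\<close> by (simp add: of_rat_less_eq)
        ultimately have "c * of_rat s < c * of_rat r" by linarith
        then have "s \<le> r" using c by (simp add: of_rat_less)
        then show ?thesis by (simp add: hom_above_below_disjoint[OF f])
      qed
      have "inf (a p) (b q) \<le> bot"
        unfolding a_def b_def SUP_inf_SUP_frame by (intro SUP_least *)
      then show ?thesis by (simp only: bot_unique)
    qed
    show "sup (a p) (b q) = top" if "p < q"
    proof -
      have "of_rat p / c < of_rat q / c"
        using that c by (simp add: divide_strict_right_mono of_rat_less)
      then obtain r where r: "of_rat p / c < of_rat r" "of_rat r < of_rat q / c"
        using of_rat_dense by blast
      then obtain s where s: "of_rat r < (of_rat s :: real)" "of_rat s < of_rat q / c"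
        using of_rat_dense[OF r(2)] by blast
      have "r < s" using s(1) by (simp add: of_rat_less)
      then have "top = sup (f (above r)) (f (below s))"
        by (rule hom_above_below_cover[OF f, symmetric])
      also have "\<dots> \<le> sup (a p) (b q)"
        using r s c by (intro sup_mono a_ge b_ge) (simp_all add: field_simps)
      finally show ?thesis by (rule top_le)
    qed
    show "a q \<le> a p" "b p \<le> b q" if "p < q"
    proof -
      have "(of_rat p :: real) < of_rat q" using that by (simp add: of_rat_less)
      then show "a q \<le> a p" "b p \<le> b q"
        unfolding a_def b_def by (intro SUP_subset_mono; auto)+
    qed
    have "f (above r) \<le> (SUP q\<in>{q. p < q}. a q)" if "of_rat p < c * of_rat r" for r
    proof -
      obtain q where "of_rat p < (of_rat q :: real)" "of_rat q < c * of_rat r"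
        using of_rat_dense[OF \<open>of_rat p < c * of_rat r\<close>] by blast
      then show ?thesis by (intro SUP_upper2[of q] a_ge) (simp_all add: of_rat_less)
    qed
    then show "a p \<le> (SUP q\<in>{q. p < q}. a q)"
      by (simp only: a_def[of p] SUP_le_iff) simp
    have "f (below r) \<le> (SUP q\<in>{q. q < p}. b q)" if "c * of_rat r < of_rat p" for r
    proof -
      obtain q where "c * of_rat r < of_rat q" "of_rat q < (of_rat p :: real)"
        using of_rat_dense[OF \<open>c * of_rat r < of_rat p\<close>] by blast
      then show ?thesis by (intro SUP_upper2[of q] b_ge) (simp_all add: of_rat_less)
    qed
    then show "b p \<le> (SUP q\<in>{q. q < p}. b q)"
      by (simp only: b_def[of p] SUP_le_iff) simp
  next
    have "f (above r) \<le> (SUP p. a p)" for r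
    proof -
      obtain p where "of_rat p < c * of_rat r"
        using of_rat_dense[of "c * of_rat r - 1" "c * of_rat r"] by auto
      then show ?thesis by (intro SUP_upper2[of p] a_ge) simp_all
    qed
    then have "(SUP r. f (above r)) \<le> (SUP p. a p)" by (rule SUP_least)
    then show "(SUP p. a p) = top" by (simp only: hom_SUP_above[OF f] top_unique)
    have "f (below r) \<le> (SUP p. b p)" for r
    proof -
      obtain p where "c * of_rat r < of_rat p"
        using of_rat_dense[of "c * of_rat r" "c * of_rat r + 1"] by auto
      then show ?thesis by (intro SUP_upper2[of p] b_ge) simp_all
    qed
    then have "(SUP r. f (below r)) \<le> (SUP p. b p)" by (rule SUP_least)
    then show "(SUP p. b p) = top" by (simp only: hom_SUP_below[OF f] top_unique)
  qed
  show "frame_hom (cont_scale_pos c f)"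
    "cont_scale_pos c f (above p) = (SUP r\<in>{r. of_rat p < c * of_rat r}. f (above r))"
    "cont_scale_pos c f (below p) = (SUP r\<in>{r. c * of_rat r < of_rat p}. f (below r))"
    unfolding cont_scale_pos_def a_def[symmetric] b_def[symmetric]
    by (simp_all add: frame_hom_extend[OF sat])
qed

lemma frame_hom_scale: "frame_hom f \<Longrightarrow> frame_hom (cont_scale c f)"
  by (simp add: cont_scale_def frame_hom_scale_pos frame_hom_const frame_hom_uminus)


section \<open>The vector space laws\<close>

context
  fixes f :: "real_frame \<Rightarrow> 'a::frame"
  assumes f: "frame_hom f"
begin

lemma cont_add_commute:
  assumes g: "frame_hom g"
  shows "cont_add f g = cont_add g f"
proof -
  have *: "cont_add f g (above p) \<le> cont_add g f (above p)"
    if "frame_hom f" "frame_hom g" for f g :: "real_frame \<Rightarrow> 'a" and p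
    unfolding add_above[OF that]
    by (rule SUP_least, subst inf_commute, rule inf_above_le_add[OF that(2,1)]) simp
  show ?thesis
    by (intro hom_eqI frame_hom_add f g antisym *)
qed

lemma cont_add_zero: "cont_add f (cont_const 0) = f"
proof (rule hom_eqI)
  note zero = frame_hom_const[of 0]
  show "frame_hom (cont_add f (cont_const 0))" by (intro frame_hom_add f zero)
  fix p
  show "cont_add f (cont_const 0) (above p) = f (above p)"
  proof (rule antisym)
    show "cont_add f (cont_const 0) (above p) \<le> f (above p)"
      unfolding add_above[OF f zero] const_above
      by (rule SUP_least) (simp add: hom_above_antimono[OF f])
    have "f (above q) \<le> cont_add f (cont_const 0) (above p)" if "p < q" for q
      using inf_above_le_add[OF f zero, of p q "p - q"] that by (simp add: const_above)
    then show "f (above p) \<le> cont_add f (cont_const 0) (above p)"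
      by (subst hom_above_SUP[OF f]) (simp only: SUP_le_iff mem_Collect_eq Ball_def, blast)
  qed
qed (rule f)

text \<open>At \<open>p\<close> the sum is the join of the images of the intervals from
  \<open>r\<close> to \<open>r - p\<close>. For \<open>p < 0\<close> they have the fixed length
  \<open>- p\<close> and cover; otherwise they are empty.\<close>

lemma cont_add_uminus: "cont_add f (cont_uminus f) = cont_const 0"
proof (rule hom_eqI)
  note uminus = frame_hom_uminus[OF f]
  show "frame_hom (cont_add f (cont_uminus f))" by (intro frame_hom_add f uminus)
  fix p
  show "cont_add f (cont_uminus f) (above p) = cont_const 0 (above p)"
  proof (cases "p < 0")
    case True
    then have "(SUP r. inf (f (above r)) (f (below (r + - p)))) = top"
      by (intro hom_narrow_cover[OF f]) simp
    with True show ?thesis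
      by (simp add: add_above[OF f uminus] uminus_above[OF f] const_above)
  next
    case False
    then have "inf (f (above r)) (f (below (r - p))) = bot" for r
      by (intro hom_above_below_disjoint[OF f]) simp
    with False show ?thesis
      by (simp add: add_above[OF f uminus] uminus_above[OF f] const_above)
  qed
qed (rule frame_hom_const)

text \<open>Negation turns \<open>above\<close> into \<open>below\<close>, where
  \<open>add_below\<close> gives a join of the same shape; only the index changes sign.\<close>

lemma cont_uminus_add:
  assumes g: "frame_hom g"
  shows "cont_uminus (cont_add f g) = cont_add (cont_uminus f) (cont_uminus g)"
proof (rule hom_eqI)
  note hom = frame_hom_uminus[OF f] frame_hom_uminus[OF g] frame_hom_add[OF f g]
  show "frame_hom (cont_uminus (cont_add f g))" by (intro frame_hom_uminus hom)
  show "frame_hom (cont_add (cont_uminus f) (cont_uminus g))" by (intro frame_hom_add hom)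
  fix p
  show "cont_uminus (cont_add f g) (above p) = cont_add (cont_uminus f) (cont_uminus g) (above p)"
    unfolding add_above[OF hom(1,2)] uminus_above[OF hom(3)] add_below[OF f g]
      uminus_above[OF f] uminus_above[OF g]
  proof (rule antisym)
    show "(SUP r. inf (f (below r)) (g (below (- p - r))))
        \<le> (SUP r. inf (f (below (- r))) (g (below (- (p - r)))))"
    proof (rule SUP_least)
      fix r show "inf (f (below r)) (g (below (- p - r)))
        \<le> (SUP r. inf (f (below (- r))) (g (below (- (p - r)))))"
        by (rule SUP_upper2[of "- r"]) (simp_all add: algebra_simps)
    qed
    show "(SUP r. inf (f (below (- r))) (g (below (- (p - r)))))
        \<le> (SUP r. inf (f (below r)) (g (below (- p - r))))"
    proof (rule SUP_least)
      fix r show "inf (f (below (- r))) (g (below (- (p - r))))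
        \<le> (SUP r. inf (f (below r)) (g (below (- p - r))))"
        by (rule SUP_upper2[of "- r"]) (simp_all add: algebra_simps)
    qed
  qed
qed

end

lemma cont_add_assoc:
  fixes f g h :: "real_frame \<Rightarrow> 'a::frame"
  assumes "frame_hom f" "frame_hom g" "frame_hom h"
  shows "cont_add (cont_add f g) h = cont_add f (cont_add g h)"
proof -
  have *: "cont_add (cont_add f g) h (above p) \<le> cont_add f (cont_add g h) (above p)"
    if hom: "frame_hom f" "frame_hom g" "frame_hom h" for f g h :: "real_frame \<Rightarrow> 'a" and p
    unfolding add_above[OF frame_hom_add[OF hom(1,2)] hom(3)] add_above[OF hom(1,2)] SUP_inf_frame
  proof (intro SUP_least)
    fix r s
    have "inf (inf (f (above s)) (g (above (r - s)))) (h (above (p - r)))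
        \<le> inf (f (above s)) (cont_add g h (above (p - s)))"
      unfolding inf_assoc by (intro inf_mono inf_above_le_add hom) simp_all
    also have "\<dots> \<le> cont_add f (cont_add g h) (above p)"
      by (intro inf_above_le_add frame_hom_add hom) simp
    finally show "inf (inf (f (above s)) (g (above (r - s)))) (h (above (p - r)))
        \<le> cont_add f (cont_add g h) (above p)" .
  qed
  \<comment> \<open>The reverse inequality is the first one for \<open>h\<close>, \<open>g\<close>,
    \<open>f\<close>, read through commutativity.\<close>
  have "cont_add f (cont_add g h) (above p) \<le> cont_add (cont_add f g) h (above p)" for p
  proof -
    have "cont_add f (cont_add g h) (above p) = cont_add (cont_add h g) f (above p)"
      using assms by (metis cont_add_commute frame_hom_add)
    also have "\<dots> \<le> cont_add h (cont_add g f) (above p)" by (intro * assms)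
    also have "\<dots> = cont_add (cont_add f g) h (above p)"
      using assms by (metis cont_add_commute frame_hom_add)
    finally show ?thesis .
  qed
  then show ?thesis
    by (intro hom_eqI frame_hom_add assms antisym * )
qed

lemma cont_add_uminus_cancel:
  assumes "frame_hom f" "frame_hom g"
  shows "cont_add (cont_add f g) (cont_uminus g) = f"
  using assms by (simp add: cont_add_assoc cont_add_uminus cont_add_zero frame_hom_uminus)

lemma cont_uminus_uminus: "frame_hom f \<Longrightarrow> cont_uminus (cont_uminus f) = f"
  by (rule hom_eqI) (simp_all add: frame_hom_uminus uminus_above uminus_below)

lemma cont_uminus_zero: "cont_uminus (cont_const 0) = cont_const 0"
  by (rule hom_eqI) (simp_all add: frame_hom_const frame_hom_uminus uminus_above const_above const_below)

section \<open>Multiplication by positive scalars\<close>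

context
  fixes f :: "real_frame \<Rightarrow> 'a::frame"
  assumes f: "frame_hom f"
begin

lemma scale_pos_add:
  assumes g: "frame_hom g" and c: "0 < c"
  shows "cont_scale_pos c (cont_add f g) = cont_add (cont_scale_pos c f) (cont_scale_pos c g)"
proof (rule hom_eqI)
  note scale = frame_hom_scale_pos[OF f c] frame_hom_scale_pos[OF g c]
  show "frame_hom (cont_scale_pos c (cont_add f g))"
    by (intro frame_hom_scale_pos frame_hom_add f g c)
  show "frame_hom (cont_add (cont_scale_pos c f) (cont_scale_pos c g))"
    by (intro frame_hom_add scale)
  fix p
  show "cont_scale_pos c (cont_add f g) (above p) =
    cont_add (cont_scale_pos c f) (cont_scale_pos c g) (above p)" (is "?l = ?r")
  proof (rule antisym)
    have "inf (f (above s)) (g (above (r - s))) \<le> ?r" if "of_rat p < c * of_rat r" for r s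
    proof -
      have "of_rat p - c * of_rat (r - s) < c * of_rat s"
        using that by (simp add: of_rat_diff algebra_simps)
      \<comment> \<open>A splitting point of a sum must be rational, while
        \<open>c * of_rat s\<close> may not be. It is chosen close enough below that number for
        \<open>p - t\<close> to stay below \<open>c * of_rat (r - s)\<close>.\<close>
      then obtain t where t: "of_rat p - c * of_rat (r - s) < of_rat t" "of_rat t < c * of_rat s"
        using of_rat_dense by blast
      have "inf (f (above s)) (g (above (r - s))) \<le>
          inf (cont_scale_pos c f (above t)) (cont_scale_pos c g (above (p - t)))"
        unfolding scale_pos_above[OF f c] scale_pos_above[OF g c]
        using t by (intro inf_mono SUP_upper) (simp_all add: of_rat_diff)
      also have "\<dots> \<le> ?r" by (intro inf_above_le_add scale) simp
      finally show ?thesis .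
    qed
    then show "?l \<le> ?r"
      unfolding scale_pos_above[OF frame_hom_add[OF f g] c] add_above[OF f g]
      by (simp add: SUP_le_iff)
    have "inf (f (above s)) (g (above t)) \<le> ?l"
      if "of_rat r < c * of_rat s" "of_rat (p - r) < c * of_rat t" for r s t
    proof -
      have "of_rat p < c * of_rat (s + t)"
        using that by (simp add: of_rat_diff of_rat_add algebra_simps)
      then show ?thesis
        unfolding scale_pos_above[OF frame_hom_add[OF f g] c]
        by (intro SUP_upper2[of "s + t"] inf_above_le_add f g) simp_all
    qed
    then show "?r \<le> ?l"
      unfolding add_above[OF scale] scale_pos_above[OF f c] scale_pos_above[OF g c]
        SUP_inf_SUP_frame by (simp add: SUP_le_iff)
  qed
qed

lemma scale_pos_uminus:
  assumes c: "0 < c"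
  shows "cont_scale_pos c (cont_uminus f) = cont_uminus (cont_scale_pos c f)"
proof (rule hom_eqI)
  show "frame_hom (cont_scale_pos c (cont_uminus f))" "frame_hom (cont_uminus (cont_scale_pos c f))"
    by (intro frame_hom_scale_pos frame_hom_uminus f c)+
  fix p
  have "f (below (- r)) \<le> (SUP s\<in>{s. c * of_rat s < of_rat (- p)}. f (below s))"
    if "of_rat p < c * of_rat r" for r
    using that by (intro SUP_upper2[of "- r"]) (simp_all add: of_rat_minus)
  moreover have "f (below s) \<le> (SUP r\<in>{r. of_rat p < c * of_rat r}. f (below (- r)))"
    if "c * of_rat s < of_rat (- p)" for s
    using that by (intro SUP_upper2[of "- s"]) (simp_all add: of_rat_minus)
  ultimately show "cont_scale_pos c (cont_uminus f) (above p) = cont_uminus (cont_scale_pos c f) (above p)"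
    unfolding scale_pos_above[OF frame_hom_uminus[OF f] c] uminus_above[OF f]
      uminus_above[OF frame_hom_scale_pos[OF f c]] scale_pos_below[OF f c]
    by (intro antisym SUP_least) simp_all
qed

lemma scale_pos_add_left:
  assumes a: "0 < a" and b: "0 < b"
  shows "cont_scale_pos (a + b) f = cont_add (cont_scale_pos a f) (cont_scale_pos b f)"
proof (rule hom_eqI)
  note scale = frame_hom_scale_pos[OF f a] frame_hom_scale_pos[OF f b]
  have ab: "0 < a + b" using a b by simp
  show "frame_hom (cont_scale_pos (a + b) f)" by (intro frame_hom_scale_pos f ab)
  show "frame_hom (cont_add (cont_scale_pos a f) (cont_scale_pos b f))" by (intro frame_hom_add scale)
  fix p
  show "cont_scale_pos (a + b) f (above p) =
    cont_add (cont_scale_pos a f) (cont_scale_pos b f) (above p)" (is "?l = ?r")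
  proof (rule antisym)
    have "f (above r) \<le> ?r" if "of_rat p < (a + b) * of_rat r" for r
    proof -
      have "of_rat p - b * of_rat r < a * of_rat r"
        using that by (simp add: algebra_simps)
      then obtain t where t: "of_rat p - b * of_rat r < of_rat t" "of_rat t < a * of_rat r"
        using of_rat_dense by blast
      have "f (above r) \<le> inf (cont_scale_pos a f (above t)) (cont_scale_pos b f (above (p - t)))"
        unfolding scale_pos_above[OF f a] scale_pos_above[OF f b]
        using t by (intro le_infI SUP_upper) (simp_all add: of_rat_diff)
      also have "\<dots> \<le> ?r" by (intro inf_above_le_add scale) simp
      finally show ?thesis .
    qed
    then show "?l \<le> ?r"
      unfolding scale_pos_above[OF f ab] by (simp add: SUP_le_iff)
    have "inf (f (above s)) (f (above t)) \<le> ?l"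
      if "of_rat r < a * of_rat s" "of_rat (p - r) < b * of_rat t" for r s t
    proof -
      \<comment> \<open>The two scaled copies may use different indices. Both bounds persist for the
        larger one, and the meet of the two values lies under the value there.\<close>
      have "a * of_rat s \<le> a * of_rat (max s t)" "b * of_rat t \<le> b * of_rat (max s t)"
        using a b by (simp_all add: of_rat_less_eq)
      then have *: "of_rat p < (a + b) * of_rat (max s t)"
        using that by (simp add: of_rat_diff algebra_simps)
      have "inf (f (above s)) (f (above t)) \<le> f (above (max s t))"
        by (simp add: max_def)
      also have "\<dots> \<le> ?l"
        unfolding scale_pos_above[OF f ab] using * by (intro SUP_upper) simp
      finally show ?thesis .
    qed
    then show "?r \<le> ?l"
      unfolding add_above[OF scale] scale_pos_above[OF f a] scale_pos_above[OF f b]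
        SUP_inf_SUP_frame by (simp add: SUP_le_iff)
  qed
qed

text \<open>The iterated join has an intermediate rational between \<open>p / a\<close> and
  \<open>b * s\<close>; density supplies it whenever \<open>p < a * b * s\<close>.\<close>

lemma scale_pos_scale_pos:
  assumes a: "0 < a" and b: "0 < b"
  shows "cont_scale_pos a (cont_scale_pos b f) = cont_scale_pos (a * b) f"
proof (rule hom_eqI)
  note scale = frame_hom_scale_pos[OF f b]
  have ab: "0 < a * b" using a b by simp
  show "frame_hom (cont_scale_pos (a * b) f)" "frame_hom (cont_scale_pos a (cont_scale_pos b f))"
    by (intro frame_hom_scale_pos f a b ab)+
  fix p
  have "f (above s) \<le> cont_scale_pos (a * b) f (above p)"
    if "of_rat p < a * of_rat r" "of_rat r < b * of_rat s" for r s
  proof -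
    have "a * of_rat r < a * (b * of_rat s)" using that(2) a by simp
    with that(1) have "of_rat p < a * b * of_rat s" by (simp add: mult.assoc)
    then show ?thesis
      unfolding scale_pos_above[OF f ab] by (intro SUP_upper) simp
  qed
  moreover have "f (above s) \<le> cont_scale_pos a (cont_scale_pos b f) (above p)"
    if "of_rat p < a * b * of_rat s" for s
  proof -
    have "of_rat p / a < b * of_rat s" using that a by (simp add: field_simps)
    then obtain r where "of_rat p / a < of_rat r" "of_rat r < b * of_rat s"
      using of_rat_dense by blast
    then show ?thesis
      unfolding scale_pos_above[OF scale a] scale_pos_above[OF f b]
      using a by (intro SUP_upper2[of r] SUP_upper) (simp_all add: field_simps)
  qed
  ultimately show "cont_scale_pos a (cont_scale_pos b f) (above p) = cont_scale_pos (a * b) f (above p)"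
    by (intro antisym)
      (simp_all add: SUP_le_iff scale_pos_above[OF f ab] scale_pos_above[OF scale a]
        scale_pos_above[OF f b])
qed

lemma scale_pos_one: "cont_scale_pos 1 f = f"
proof (rule hom_eqI)
  show "cont_scale_pos 1 f (above p) = f (above p)" for p
    by (simp add: scale_pos_above[OF f] hom_above_SUP[OF f, of p] of_rat_less)
qed (simp_all add: f frame_hom_scale_pos)

end

lemma scale_pos_zero:
  assumes "0 < c" shows "cont_scale_pos c (cont_const 0) = (cont_const 0 :: _ \<Rightarrow> 'a::frame)"
proof (rule hom_eqI)
  note zero = frame_hom_const[of 0]
  show "frame_hom (cont_scale_pos c (cont_const 0) :: _ \<Rightarrow> 'a)"
    by (intro frame_hom_scale_pos zero assms)
  fix p
  have iff: "(\<exists>r::rat. of_rat p < c * of_rat r \<and> r < 0) \<longleftrightarrow> p < 0"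
  proof
    assume "\<exists>r::rat. of_rat p < c * of_rat r \<and> r < 0"
    then obtain r where r: "of_rat p < c * of_rat r" "r < 0" by blast
    then have "c * of_rat r < 0" using assms by (simp add: mult_pos_neg)
    with r have "(of_rat p :: real) < 0" by linarith
    then show "p < 0" by simp
  next
    assume "p < 0"
    then have "of_rat p / c < 0" using assms by (simp add: divide_neg_pos)
    then obtain r where "of_rat p / c < of_rat r" "of_rat r < (0::real)" using of_rat_dense by blast
    then show "\<exists>r::rat. of_rat p < c * of_rat r \<and> r < 0"
      using assms by (intro exI[of _ r]) (simp add: field_simps)
  qed
  show "cont_scale_pos c (cont_const 0) (above p) = (cont_const 0 (above p) :: 'a)"
  proof (cases "p < 0")
    case True
    then obtain r :: rat where "of_rat p < c * of_rat r" "r < 0" using iff by blast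
    then have "cont_const 0 (above r) \<le> (cont_scale_pos c (cont_const 0) (above p) :: 'a)"
      unfolding scale_pos_above[OF zero assms] by (intro SUP_upper) simp
    with True \<open>r < 0\<close> show ?thesis by (simp add: const_above top_unique)
  next
    case False
    then have "\<not> r < 0" if "of_rat p < c * of_rat r" for r :: rat
      using that iff by blast
    with False show ?thesis
      by (simp add: scale_pos_above[OF zero assms] const_above)
  qed
qed (rule frame_hom_const)

section \<open>Scalars of arbitrary sign\<close>

lemma cont_scale_add_right:
  fixes f g :: "real_frame \<Rightarrow> 'a::frame"
  assumes "frame_hom f" "frame_hom g"
  shows "cont_scale c (cont_add f g) = cont_add (cont_scale c f) (cont_scale c g)"
  using assms
  by (simp add: cont_scale_def scale_pos_add cont_uminus_add frame_hom_scale_pos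
      cont_add_zero frame_hom_const)

lemma cont_scale_uminus_left:
  "frame_hom f \<Longrightarrow> cont_scale (- c) f = cont_uminus (cont_scale c f)"
  by (simp add: cont_scale_def cont_uminus_uminus cont_uminus_zero frame_hom_scale_pos)

lemma cont_scale_uminus_right:
  "frame_hom f \<Longrightarrow> cont_scale c (cont_uminus f) = cont_uminus (cont_scale c f)"
  by (simp add: cont_scale_def cont_uminus_zero scale_pos_uminus)

lemma cont_add_uminus_eqI:
  assumes "frame_hom h" "frame_hom g" "f = cont_add h g"
  shows "h = cont_add f (cont_uminus g)"
  using assms by (simp add: cont_add_uminus_cancel)

text \<open>As \<open>cont_scale\<close> is defined by sign, the law is first proved for nonnegative
  scalars. If \<open>0 \<le> a + b\<close> and \<open>b \<le> 0\<close>, that case for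
  \<open>a = (a + b) + (- b)\<close> gives it by cancellation; negating both scalars handles
  \<open>a + b < 0\<close>.\<close>

lemma cont_scale_add_left:
  fixes f :: "real_frame \<Rightarrow> 'a::frame"
  assumes f: "frame_hom f"
  shows "cont_scale (a + b) f = cont_add (cont_scale a f) (cont_scale b f)"
proof -
  note hom = frame_hom_scale[OF f]
  have nonneg: "cont_scale (a + b) f = cont_add (cont_scale a f) (cont_scale b f)"
    if "0 \<le> a" "0 \<le> b" for a b
  proof (cases "a = 0 \<or> b = 0")
    case True
    then show ?thesis
      using cont_add_zero[OF hom] cont_add_commute[OF hom frame_hom_const]
      by (auto simp: cont_scale_def[of 0])
  next
    case False
    with that show ?thesis by (simp add: cont_scale_def scale_pos_add_left[OF f])
  qed
  have neg: "cont_scale (- a - b) f = cont_add (cont_scale (- a) f) (cont_scale (- b) f) \<longleftrightarrow>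
      cont_scale (a + b) f = cont_add (cont_scale a f) (cont_scale b f)" for a b
  proof -
    have "cont_scale (- a - b) f = cont_uminus (cont_scale (a + b) f)"
      using cont_scale_uminus_left[OF f, of "a + b"] by simp
    moreover have "cont_add (cont_scale (- a) f) (cont_scale (- b) f) =
        cont_uminus (cont_add (cont_scale a f) (cont_scale b f))"
      by (simp add: cont_scale_uminus_left[OF f] cont_uminus_add[OF hom hom])
    ultimately show ?thesis
      by (metis cont_uminus_uminus frame_hom_add hom)
  qed
  have mixed: "cont_scale (a + b) f = cont_add (cont_scale a f) (cont_scale b f)"
    if "0 \<le> a + b" "b \<le> 0" for a b
  proof -
    have "cont_scale (a + b) f = cont_add (cont_scale a f) (cont_uminus (cont_scale (- b) f))"
      using nonneg[of "a + b" "- b"] that by (intro cont_add_uminus_eqI hom) simp_all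
    then show ?thesis by (simp add: cont_scale_uminus_left[OF f, symmetric])
  qed
  have *: "cont_scale (a + b) f = cont_add (cont_scale a f) (cont_scale b f)"
    if "0 \<le> a + b" for a b
  proof -
    consider "0 \<le> a" "0 \<le> b" | "b \<le> 0" | "a \<le> 0" by linarith
    then show ?thesis
    proof cases
      case 3
      then show ?thesis
        using mixed[of b a] that by (metis add.commute cont_add_commute hom)
    qed (use that nonneg mixed in blast)+
  qed
  show ?thesis
  proof (cases "0 \<le> a + b")
    case True
    then show ?thesis by (rule * )
  next
    case False
    then have "0 \<le> - a + - b" by simp
    from *[OF this] show ?thesis using neg[of a b] by simp
  qed
qed

text \<open>Signs are moved first out of \<open>b\<close> and then out of \<open>a\<close> as
  negations, until both scalars are nonnegative.\<close>

lemma cont_scale_scale: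
  fixes f :: "real_frame \<Rightarrow> 'a::frame"
  assumes f: "frame_hom f"
  shows "cont_scale a (cont_scale b f) = cont_scale (a * b) f"
proof -
  have pos: "cont_scale a (cont_scale b f) = cont_scale (a * b) f" if "0 \<le> a" "0 \<le> b" for a b
    using that f by (auto simp: cont_scale_def scale_pos_scale_pos scale_pos_zero)
  have right: "cont_scale a (cont_scale b f) = cont_scale (a * b) f" if "0 \<le> a" for a b
  proof (cases "0 \<le> b")
    case False
    then have "cont_scale a (cont_scale (- b) f) = cont_scale (a * - b) f"
      using that by (intro pos) simp_all
    then show ?thesis
      by (metis cont_scale_uminus_left[OF f] cont_scale_uminus_right cont_uminus_uminus
          frame_hom_scale[OF f] frame_hom_uminus minus_minus mult_minus_right)
  qed (simp add: pos that)
  show ?thesis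
  proof (cases "0 \<le> a")
    case False
    then have "cont_scale (- a) (cont_scale b f) = cont_scale (- a * b) f" by (intro right) simp
    then show ?thesis
      by (metis cont_scale_uminus_left[OF f] cont_scale_uminus_left[OF frame_hom_scale[OF f]]
          minus_minus mult_minus_left)
  qed (simp add: right)
qed


section \<open>The Riesz space of continuous real functions\<close>

lemma pseudocomplement_sup:
  "pseudocomplement (sup a b) = inf (pseudocomplement a) (pseudocomplement b)"
proof (rule antisym)
  have "inf (sup a b) (inf (pseudocomplement a) (pseudocomplement b)) = bot"
    by (simp add: inf_sup_distrib2 le_pseudocomplement[symmetric])
  then show "inf (pseudocomplement a) (pseudocomplement b) \<le> pseudocomplement (sup a b)"
    by (simp add: le_pseudocomplement)
qed (simp add: pseudocomplement_antimono)

lemma rather_below_sup: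
  assumes "rather_below b a" "rather_below b' a'"
  shows "rather_below (sup b b') (sup a a')"
  using assms unfolding rather_below_def pseudocomplement_sup sup_inf_distrib2
  by (metis inf_top_left sup_assoc sup_left_commute sup_top_left sup_top_right)

lemma rather_below_inf:
  assumes "rather_below b a" "rather_below b' a'"
  shows "rather_below (inf b b') (inf a a')"
proof -
  have "sup (pseudocomplement b) a \<le> sup (pseudocomplement (inf b b')) a"
    "sup (pseudocomplement b') a' \<le> sup (pseudocomplement (inf b b')) a'"
    by (intro sup_mono pseudocomplement_antimono; simp)+
  with assms show ?thesis
    by (simp add: rather_below_def sup_inf_distrib1 top_unique)
qed

context
  fixes f g :: "real_frame \<Rightarrow> 'a::frame"
  assumes f: "frame_hom f" and g: "frame_hom g"
begin

text \<open>The pointwise join is a scale. Its pseudocomplements are meets of two increasing covers,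
  hence cover along the diagonal; (r3) for \<open>f\<close> and \<open>g\<close> shows that the
  induced function has the same values.\<close>

lemma ex_cont_sup:
  obtains h where "frame_hom h" "\<And>p. h (above p) = sup (f (above p)) (g (above p))"
proof -
  let ?c = "\<lambda>p. sup (f (above p)) (g (above p))"
  have "mono (\<lambda>p. pseudocomplement (f (above p)))" "mono (\<lambda>p. pseudocomplement (g (above p)))"
    by (intro monoI pseudocomplement_antimono hom_above_antimono f g; assumption)+
  then have pc: "(SUP s. pseudocomplement (?c s)) = top"
    unfolding pseudocomplement_sup
    by (intro SUP_inf_mono_eq_top hom_SUP_pseudocomplement_above f g)
  have "(SUP s. f (above s)) \<le> (SUP s. ?c s)" by (intro SUP_mono') simp
  then have c: "(SUP s. ?c s) = top"
    by (simp only: hom_SUP_above[OF f] top_unique)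
  have rb: "rather_below (?c t) (?c s)" if "s < t" for s t
    using that by (intro rather_below_sup hom_above_rather_below f g)
  obtain h where h: "frame_hom h" "\<And>p. h (above p) = (SUP s\<in>{s. p < s}. ?c s)"
    using hom_of_scale[OF rb c pc] by blast
  have "h (above p) = ?c p" for p
    unfolding h(2) hom_above_SUP[OF f, of p] hom_above_SUP[OF g, of p]
    by (rule Complete_Lattices.SUP_sup_distrib[symmetric])
  with h(1) show thesis by (rule that)
qed

text \<open>Here the scale itself, not its pseudocomplements, needs the diagonal argument, and (r3)
  is recovered by passing from \<open>s\<close> and \<open>t\<close> to
  \<open>min s t\<close>.\<close>

lemma ex_cont_inf:
  obtains h where "frame_hom h" "\<And>p. h (above p) = inf (f (above p)) (g (above p))"
proof -
  let ?c = "\<lambda>p. inf (f (above p)) (g (above p))"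
  have "(SUP s. pseudocomplement (f (above s))) \<le> (SUP s. pseudocomplement (?c s))"
    by (intro SUP_mono' pseudocomplement_antimono) simp
  then have pc: "(SUP s. pseudocomplement (?c s)) = top"
    by (simp only: hom_SUP_pseudocomplement_above[OF f] top_unique)
  have c: "(SUP s. ?c s) = top"
    by (intro SUP_inf_antimono_eq_top antimono_hom_above hom_SUP_above f g)
  have rb: "rather_below (?c t) (?c s)" if "s < t" for s t
    using that by (intro rather_below_inf hom_above_rather_below f g)
  obtain h where h: "frame_hom h" "\<And>p. h (above p) = (SUP s\<in>{s. p < s}. ?c s)"
    using hom_of_scale[OF rb c pc] by blast
  have "h (above p) = ?c p" for p
  proof (rule antisym)
    show "h (above p) \<le> ?c p"
      unfolding h(2) by (intro SUP_least inf_mono hom_above_antimono f g) simp_all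
    have "inf (f (above s)) (g (above t)) \<le> h (above p)" if "p < s" "p < t" for s t
    proof -
      have "inf (f (above s)) (g (above t)) \<le> ?c (min s t)"
        by (intro inf_mono hom_above_antimono f g) simp_all
      also have "\<dots> \<le> h (above p)"
        unfolding h(2) using that by (intro SUP_upper) simp
      finally show ?thesis .
    qed
    then show "?c p \<le> h (above p)"
      unfolding hom_above_SUP[OF f, of p] hom_above_SUP[OF g, of p] SUP_inf_SUP_frame
      by (simp add: SUP_le_iff)
  qed
  with h(1) show thesis by (rule that)
qed

end

lemma cont_real_simps [simp]:
  "carrier (cont_real TYPE('a::frame)) = {f. frame_hom f}"
  "eq (cont_real TYPE('a)) = (=)"
  "le (cont_real TYPE('a)) = (\<lambda>f g. \<forall>p. f (above p) \<le> g (above p))"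
  "add (cont_real TYPE('a)) = cont_add"
  "zero (cont_real TYPE('a)) = cont_const 0"
  "scale (cont_real TYPE('a)) = cont_scale"
  by (simp_all add: cont_real_def)

lemma is_supremum_cont_real:
  fixes s :: "real_frame \<Rightarrow> 'a::frame"
  assumes "A \<subseteq> {f. frame_hom f}" "frame_hom s"
    and "\<And>f p. f \<in> A \<Longrightarrow> f (above p) \<le> s (above p)"
    and "\<And>u p. frame_hom u \<Longrightarrow> (\<And>f p. f \<in> A \<Longrightarrow> f (above p) \<le> u (above p)) \<Longrightarrow>
      s (above p) \<le> u (above p)"
  shows "is_supremum (cont_real TYPE('a)) A s"
  unfolding is_supremum_def least_def
proof (intro conjI ballI)
  show "s \<in> Upper (cont_real TYPE('a)) A"
    using assms(1-3) by (auto simp: Upper_def)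
  fix u assume u: "u \<in> Upper (cont_real TYPE('a)) A"
  then have "frame_hom u" "\<And>f p. f \<in> A \<Longrightarrow> f (above p) \<le> u (above p)"
    using assms(1) by (auto simp: Upper_def)
  then show "s \<sqsubseteq>\<^bsub>cont_real TYPE('a)\<^esub> u" by (simp add: assms(4))
qed (auto simp: Upper_def)

context
  fixes f g h :: "real_frame \<Rightarrow> 'a::frame"
  assumes f: "frame_hom f" and g: "frame_hom g" and h: "frame_hom h"
begin

lemma least_cont_sup:
  assumes "\<And>p. h (above p) = sup (f (above p)) (g (above p))"
  shows "least (cont_real TYPE('a)) h (Upper (cont_real TYPE('a)) {f, g})"
  using f g h assms
  by (intro is_supremum_cont_real[unfolded is_supremum_def]) auto

lemma greatest_cont_inf:
  assumes "\<And>p. h (above p) = inf (f (above p)) (g (above p))"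
  shows "greatest (cont_real TYPE('a)) h (Lower (cont_real TYPE('a)) {f, g})"
  using f g h assms by (auto simp: greatest_def Lower_def)

end

lemma lattice_cont_real: "lattice (cont_real TYPE('a::frame))"
proof -
  have "f = g" if "frame_hom f" "frame_hom g"
    "\<forall>p. f (above p) \<le> g (above p)" "\<forall>p. g (above p) \<le> f (above p)" for f g :: "real_frame \<Rightarrow> 'a"
    using that by (intro hom_eqI antisym) simp_all
  then interpret partial_order "cont_real TYPE('a)"
    by unfold_locales (auto intro: order_trans)
  show ?thesis
  proof
    fix f g :: "real_frame \<Rightarrow> 'a"
    assume "f \<in> carrier (cont_real TYPE('a))" "g \<in> carrier (cont_real TYPE('a))"
    then have fg: "frame_hom f" "frame_hom g" by simp_all
    show "\<exists>s. least (cont_real TYPE('a)) s (Upper (cont_real TYPE('a)) {f, g})"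
      using ex_cont_sup[OF fg] least_cont_sup[OF fg] by metis
    show "\<exists>s. greatest (cont_real TYPE('a)) s (Lower (cont_real TYPE('a)) {f, g})"
      using ex_cont_inf[OF fg] greatest_cont_inf[OF fg] by metis
  qed
qed

context
  fixes f g :: "real_frame \<Rightarrow> 'a::frame"
  assumes f: "frame_hom f" and g: "frame_hom g"
begin

text \<open>The join of the order structure is only known as a least upper bound; uniqueness
  identifies it with the pointwise one.\<close>

lemma join_above:
  "(f \<squnion>\<^bsub>cont_real TYPE('a)\<^esub> g) (above p) = sup (f (above p)) (g (above p))"
proof -
  interpret lattice "cont_real TYPE('a)" by (rule lattice_cont_real)
  obtain h where h: "frame_hom h" "\<And>p. h (above p) = sup (f (above p)) (g (above p))"
    using ex_cont_sup[OF f g] by blast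
  have "f \<squnion>\<^bsub>cont_real TYPE('a)\<^esub> g = h"
    unfolding join_def using f g
    by (intro least_unique[OF sup_of_two_least least_cont_sup[OF f g h]]) simp_all
  with h(2) show ?thesis by simp
qed

lemma meet_above:
  "(f \<sqinter>\<^bsub>cont_real TYPE('a)\<^esub> g) (above p) = inf (f (above p)) (g (above p))"
proof -
  interpret lattice "cont_real TYPE('a)" by (rule lattice_cont_real)
  obtain h where h: "frame_hom h" "\<And>p. h (above p) = inf (f (above p)) (g (above p))"
    using ex_cont_inf[OF f g] by blast
  have "f \<sqinter>\<^bsub>cont_real TYPE('a)\<^esub> g = h"
    unfolding meet_def using f g
    by (intro greatest_unique[OF inf_of_two_greatest greatest_cont_inf[OF f g h]]) simp_all
  with h(2) show ?thesis by simp
qed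

lemma frame_hom_join: "frame_hom (f \<squnion>\<^bsub>cont_real TYPE('a)\<^esub> g)"
  and frame_hom_meet: "frame_hom (f \<sqinter>\<^bsub>cont_real TYPE('a)\<^esub> g)"
proof -
  interpret lattice "cont_real TYPE('a)" by (rule lattice_cont_real)
  show "frame_hom (f \<squnion>\<^bsub>cont_real TYPE('a)\<^esub> g)" "frame_hom (f \<sqinter>\<^bsub>cont_real TYPE('a)\<^esub> g)"
    using f g join_closed meet_closed by simp_all
qed

end

text \<open>The zero function is top at negative rationals and bottom at all others, so only the
  former impose a condition.\<close>

lemma cont_nonneg_iff:
  "(\<forall>p. cont_const 0 (above p) \<le> f (above p)) \<longleftrightarrow> (\<forall>p<0. f (above p) = (top :: 'a::frame))"
  by (auto simp: const_above top_unique split: if_splits)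

section \<open>The Riesz space axioms\<close>

lemma riesz_space_cont_real: "riesz_space (cont_real TYPE('a::frame))"
proof -
  interpret lattice "cont_real TYPE('a)" by (rule lattice_cont_real)
  show ?thesis
  proof (intro riesz_space.intro riesz_space_axioms.intro lattice_cont_real)
    show "comm_group \<lparr>carrier = carrier (cont_real TYPE('a)),
      monoid.mult = (\<oplus>\<^bsub>cont_real TYPE('a)\<^esub>), one = \<zero>\<^bsub>cont_real TYPE('a)\<^esub>\<rparr>"
    proof (rule comm_groupI, simp_all add: frame_hom_add frame_hom_const cont_add_assoc)
      fix f g :: "real_frame \<Rightarrow> 'a"
      assume f: "frame_hom f"
      show "cont_add (cont_const 0) f = f"
        using cont_add_zero[OF f] cont_add_commute[OF f frame_hom_const] by metis
      show "\<exists>g. frame_hom g \<and> cont_add g f = cont_const 0"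
        using cont_add_uminus[OF f] cont_add_commute[OF f frame_hom_uminus[OF f]]
          frame_hom_uminus[OF f] by metis
      assume g: "frame_hom g"
      show "cont_add f g = cont_add g f" by (rule cont_add_commute[OF f g])
    qed
  next
    fix f g h :: "real_frame \<Rightarrow> 'a" and c :: real
    let ?R = "cont_real TYPE('a)"
    assume "f \<in> carrier ?R"
    then have f: "frame_hom f" by simp
    show "1 \<odot>\<^bsub>?R\<^esub> f = f" using f by (simp add: cont_scale_def scale_pos_one)
    show "\<zero>\<^bsub>?R\<^esub> \<sqsubseteq>\<^bsub>?R\<^esub> c \<odot>\<^bsub>?R\<^esub> f" if "\<zero>\<^bsub>?R\<^esub> \<sqsubseteq>\<^bsub>?R\<^esub> f" "0 \<le> c"
    proof (cases "c = 0")
      case False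
      with that have c: "0 < c" by simp
      have "cont_scale_pos c f (above p) = top" if "p < 0" for p
      proof -
        have "of_rat p / c < 0" using \<open>p < 0\<close> c by (simp add: divide_neg_pos)
        then obtain r where "of_rat p / c < of_rat r" "of_rat r < (0::real)"
          using of_rat_dense by blast
        moreover have "\<forall>p<0. f (above p) = top"
          using \<open>\<zero>\<^bsub>?R\<^esub> \<sqsubseteq>\<^bsub>?R\<^esub> f\<close> by (simp add: cont_nonneg_iff)
        ultimately show ?thesis
          unfolding scale_pos_above[OF f c] using c
          by (intro top_le SUP_upper2[of r]) (simp_all add: field_simps)
      qed
      with c show ?thesis by (simp add: cont_nonneg_iff cont_scale_def)
    qed (simp add: cont_scale_def)
    assume "g \<in> carrier ?R" "h \<in> carrier ?R"
    then have g: "frame_hom g" and h: "frame_hom h" by simp_all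
    show "f \<oplus>\<^bsub>?R\<^esub> h \<sqsubseteq>\<^bsub>?R\<^esub> g \<oplus>\<^bsub>?R\<^esub> h" if "f \<sqsubseteq>\<^bsub>?R\<^esub> g"
      using that by (auto simp: add_above[OF f h] add_above[OF g h] intro!: SUP_mono' inf_mono)
  qed (simp_all add: frame_hom_scale cont_scale_add_right cont_scale_add_left cont_scale_scale)
qed

section \<open>Completeness over Boolean frames\<close>

context
  assumes boolean: "\<And>x :: 'a::frame. sup x (pseudocomplement x) = top"
begin

lemma boolean_rather_below: "b \<le> a \<Longrightarrow> rather_below b (a :: 'a)"
  using boolean[of b] unfolding rather_below_def
  by (metis sup.absorb_iff2 sup_assoc sup_commute sup_top_left)

text \<open>Over a Boolean frame the antitone pointwise join is automatically a scale, so the only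
  obstruction is infinite values; \<open>bounded\<close> excludes them. Interchanging joins shows
  that the induced function is the pointwise join.\<close>

lemma boolean_ex_supremum:
  fixes A :: "(real_frame \<Rightarrow> 'a) set"
  assumes A: "A \<subseteq> {f. frame_hom f}" "A \<noteq> {}"
    and bounded: "(SUP p. pseudocomplement (SUP f\<in>A. f (above p))) = top"
  obtains s where "is_supremum (cont_real TYPE('a)) A s"
proof -
  let ?c = "\<lambda>p. SUP f\<in>A. f (above p)"
  have A_hom: "frame_hom f" if "f \<in> A" for f using that A by blast
  have rb: "rather_below (?c t) (?c s)" if "s < t" for s t
  proof (intro boolean_rather_below SUP_mono)
    fix f assume "f \<in> A"
    with that show "\<exists>g\<in>A. f (above t) \<le> g (above s)"
      by (intro bexI[of _ f] hom_above_antimono[OF A_hom]) simp_all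
  qed
  have c: "(SUP s. ?c s) = top"
  proof (rule top_le)
    obtain f where f: "f \<in> A" using A by blast
    have "(SUP s. f (above s)) \<le> (SUP s. ?c s)"
      using f by (intro SUP_mono' SUP_upper)
    then show "top \<le> (SUP s. ?c s)" by (simp only: hom_SUP_above[OF A_hom[OF f]])
  qed
  obtain h where h: "frame_hom h" "\<And>p. h (above p) = (SUP s\<in>{s. p < s}. ?c s)"
    using hom_of_scale[OF rb c bounded] by blast
  have h_above: "h (above p) = ?c p" for p
    unfolding h(2) by (subst SUP_commute) (intro SUP_cong refl hom_above_SUP[symmetric] A_hom)
  have "is_supremum (cont_real TYPE('a)) A h"
    by (rule is_supremum_cont_real[OF A(1) h(1)]) (auto simp: h_above intro: SUP_upper SUP_least)
  then show thesis by (rule that)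
qed

lemma boolean_dedekind_complete: "dedekind_complete (cont_real TYPE('a))"
  unfolding dedekind_complete_def
proof (intro allI impI)
  fix A assume A: "A \<subseteq> carrier (cont_real TYPE('a))" "A \<noteq> {}"
  assume "Upper (cont_real TYPE('a)) A \<noteq> {}"
  then obtain u where u: "frame_hom u" "\<And>f p. f \<in> A \<Longrightarrow> f (above p) \<le> u (above p)"
    using A by (auto simp: Upper_def)
  then have "(SUP p. pseudocomplement (u (above p))) \<le>
      (SUP p. pseudocomplement (SUP f\<in>A. f (above p)))"
    by (intro SUP_mono' pseudocomplement_antimono SUP_least)
  then have "(SUP p. pseudocomplement (SUP f\<in>A. f (above p))) = top"
    by (simp only: hom_SUP_pseudocomplement_above[OF u(1)] top_unique)
  with A show "\<exists>s. is_supremum (cont_real TYPE('a)) A s"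
    by (auto intro: boolean_ex_supremum[of A])
qed

text \<open>
  The supremum of a disjoint family is bounded: where it takes the value \<open>\<infinity>\<close>, some member of the
  family is positive, hence is there the only nonzero one, hence takes the value \<open>\<infinity>\<close> itself.
\<close>

lemma boolean_laterally_complete: "laterally_complete (cont_real TYPE('a))"
  unfolding laterally_complete_def
proof (intro allI impI)
  fix A assume A: "A \<subseteq> pos_cone (cont_real TYPE('a))" "A \<noteq> {}"
    and disjoint: "pairwise (\<lambda>g h. g \<sqinter>\<^bsub>cont_real TYPE('a)\<^esub> h = \<zero>\<^bsub>cont_real TYPE('a)\<^esub>) A"
  have A_hom: "frame_hom f" if "f \<in> A" for f
    using that A by (auto simp: pos_cone_def)
  have bot: "inf (f (above 0)) (g (above 0)) = bot" if "f \<in> A" "g \<in> A" "f \<noteq> g" for f g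
  proof -
    have "f \<sqinter>\<^bsub>cont_real TYPE('a)\<^esub> g = cont_const 0"
      using disjoint that by (simp add: pairwise_def)
    then have "inf (f (above 0)) (g (above 0)) = cont_const 0 (above 0)"
      using meet_above[OF A_hom A_hom, of f g 0] that by simp
    then show ?thesis by (simp add: const_above)
  qed
  let ?c = "\<lambda>p. SUP f\<in>A. f (above p)"
  \<comment> \<open>This is the region where the pointwise join is finite, so its pseudocomplement
    is the region of the value \<open>\<infinity>\<close>, to be shown empty.\<close>
  define x where "x = (SUP p. pseudocomplement (?c p))"
  have le_c: "pseudocomplement x \<le> ?c p" for p
  proof (rule le_of_inf_le_of_sup_eq_top[OF boolean[of "?c p"]])
    have "inf (pseudocomplement x) (pseudocomplement (?c p)) \<le> inf (pseudocomplement x) x"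
      unfolding x_def by (intro inf_mono SUP_upper) simp_all
    then show "inf (pseudocomplement x) (pseudocomplement (?c p)) \<le> ?c p"
      by (simp add: inf_commute bot_unique)
  qed simp
  have "inf (pseudocomplement x) (f (above 0)) \<le> bot" if f: "f \<in> A" for f
  proof -
    let ?e = "inf (pseudocomplement x) (f (above 0))"
    note f_hom = A_hom[OF f]
    \<comment> \<open>On \<open>?e\<close> the function \<open>f\<close> is positive, which excludes
      every other member there. As \<open>?e \<le> ?c p\<close>, only \<open>f\<close> can account
      for it.\<close>
    have le: "?e \<le> f (above p)" for p
    proof (cases "p \<le> 0")
      case True
      then show ?thesis by (intro le_infI2 hom_above_antimono[OF f_hom])
    next
      case False
      have "inf ?e (g (above p)) \<le> f (above p)" if g: "g \<in> A" for g
      proof (cases "g = f")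
        case False
        have "inf ?e (g (above p)) \<le> inf (f (above 0)) (g (above 0))"
          using \<open>\<not> p \<le> 0\<close> by (intro inf_mono hom_above_antimono[OF A_hom[OF g]]) simp_all
        with bot[OF f g] False show ?thesis by (simp add: bot_unique)
      qed simp
      then have "inf ?e (?c p) \<le> f (above p)" unfolding inf_SUP_frame by (rule SUP_least)
      moreover have "?e \<le> ?c p" by (intro le_infI1 le_c)
      ultimately show ?thesis by (simp add: inf.absorb1)
    qed
    \<comment> \<open>A function on a frame is nowhere infinite: its values on \<open>below\<close>
      cover, and \<open>?e\<close> is disjoint from each of them.\<close>
    show ?thesis
    proof (rule le_of_inf_le_of_SUP_eq_top[OF hom_SUP_below[OF f_hom]])
      fix p
      have "inf ?e (f (below p)) \<le> inf (f (above p)) (f (below p))" by (intro inf_mono le) simp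
      then show "inf ?e (f (below p)) \<le> bot" by (simp add: hom_above_below_disjoint[OF f_hom])
    qed
  qed
  then have "inf (pseudocomplement x) (?c 0) \<le> bot" unfolding inf_SUP_frame by (rule SUP_least)
  then have "pseudocomplement x = bot" using le_c[of 0] by (simp add: inf.absorb1 bot_unique)
  then have "x = top" using boolean[of x] by simp
  then obtain s where "is_supremum (cont_real TYPE('a)) A s"
    using boolean_ex_supremum[of A] A A_hom unfolding x_def by blast
  then show "\<exists>s. is_supremum (cont_real TYPE('a)) A s" by blast
qed

end


section \<open>The embedding into the functions on the Booleanization\<close>

text \<open>The candidate \<open>y\<close> is the pseudocomplement taken in the original frame. The
  join is regularized, so De Morgan turns it into the pseudocomplement of bottom; \<open>y\<close>
  need only lie below the pseudocomplement in the Booleanization.\<close>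

lemma booleanization_boolean: "sup x (pseudocomplement x) = (top :: 'a::frame booleanization)"
proof -
  define y where "y = booleanize (pseudocomplement (Rep_booleanization x))"
  note rep = Rep_booleanization_inject[symmetric] y_def booleanize.rep_eq
  have "inf x y = bot"
    unfolding rep inf_booleanization.rep_eq bot_booleanization.rep_eq by simp
  then have "sup x y \<le> sup x (pseudocomplement x)"
    by (intro sup_mono) (simp_all add: le_pseudocomplement)
  moreover have "sup x y = top"
    unfolding rep sup_booleanization.rep_eq top_booleanization.rep_eq by (simp add: pseudocomplement_sup)
  ultimately show ?thesis by (simp add: top_unique)
qed

lemma frame_hom_booleanize: "frame_hom booleanize"
proof (rule frame_homI)
  note rep = Rep_booleanization_inject[symmetric] booleanize.rep_eq
  show "booleanize top = (top :: 'a booleanization)"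
    unfolding rep top_booleanization.rep_eq by (intro antisym le_regularize top_greatest)
  show "booleanize (inf a b) = inf (booleanize a) (booleanize b)" for a b :: 'a
    unfolding rep inf_booleanization.rep_eq by (rule inf_regularize[symmetric])
  show "booleanize (Sup A) = (SUP a\<in>A. booleanize a)" for A :: "'a set"
    unfolding rep Sup_booleanization.rep_eq image_image
  proof (rule antisym)
    show "regularize (Sup A) \<le> regularize (SUP a\<in>A. regularize a)"
      by (intro regularize_mono Sup_least) (rule SUP_upper2, assumption, rule le_regularize)
    have "(SUP a\<in>A. regularize a) \<le> regularize (Sup A)"
      by (intro SUP_least regularize_mono Sup_upper)
    then show "regularize (SUP a\<in>A. regularize a) \<le> regularize (Sup A)"
      using regularize_mono by fastforce
  qed
qed

lemma booleanize_Rep: "booleanize (Rep_booleanization x) = x"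
  using Rep_booleanization[of x]
  by (simp add: Rep_booleanization_inject[symmetric] booleanize.rep_eq)

section \<open>Composition with a frame homomorphism\<close>

lemma comp_const: "frame_hom \<beta> \<Longrightarrow> \<beta> \<circ> cont_const r = cont_const r"
  by (rule hom_eqI)
    (simp_all add: frame_hom_comp frame_hom_const const_above frame_hom_top frame_hom_bot)

context
  fixes \<beta> :: "'a::frame \<Rightarrow> 'b::frame" and f :: "real_frame \<Rightarrow> 'a"
  assumes \<beta>: "frame_hom \<beta>" and f: "frame_hom f"
begin

lemma comp_uminus: "\<beta> \<circ> cont_uminus f = cont_uminus (\<beta> \<circ> f)"
  by (rule hom_eqI)
    (simp_all add: frame_hom_comp \<beta> f frame_hom_uminus uminus_above)

lemma comp_add:
  assumes g: "frame_hom g"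
  shows "\<beta> \<circ> cont_add f g = cont_add (\<beta> \<circ> f) (\<beta> \<circ> g)"
  by (rule hom_eqI)
    (simp_all add: frame_hom_comp \<beta> f g frame_hom_add add_above
      frame_hom_SUP[OF \<beta>] frame_hom_inf[OF \<beta>])

lemma comp_scale_pos: "0 < c \<Longrightarrow> \<beta> \<circ> cont_scale_pos c f = cont_scale_pos c (\<beta> \<circ> f)"
  by (rule hom_eqI)
    (simp_all add: frame_hom_comp \<beta> f frame_hom_scale_pos scale_pos_above frame_hom_SUP[OF \<beta>])

lemma comp_join:
  assumes g: "frame_hom g"
  shows "\<beta> \<circ> (f \<squnion>\<^bsub>cont_real TYPE('a)\<^esub> g) = (\<beta> \<circ> f) \<squnion>\<^bsub>cont_real TYPE('b)\<^esub> (\<beta> \<circ> g)"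
  by (rule hom_eqI)
    (simp_all add: frame_hom_comp \<beta> f g frame_hom_join join_above frame_hom_sup[OF \<beta>])

lemma comp_meet:
  assumes g: "frame_hom g"
  shows "\<beta> \<circ> (f \<sqinter>\<^bsub>cont_real TYPE('a)\<^esub> g) = (\<beta> \<circ> f) \<sqinter>\<^bsub>cont_real TYPE('b)\<^esub> (\<beta> \<circ> g)"
  by (rule hom_eqI)
    (simp_all add: frame_hom_comp \<beta> f g frame_hom_meet meet_above frame_hom_inf[OF \<beta>])

end

lemma comp_scale:
  "frame_hom \<beta> \<Longrightarrow> frame_hom f \<Longrightarrow> \<beta> \<circ> cont_scale c f = cont_scale c (\<beta> \<circ> f)"
  by (simp add: cont_scale_def comp_const comp_uminus comp_scale_pos frame_hom_scale_pos)

text \<open>Of the cover by \<open>pseudocomplement b\<close> and \<open>a\<close>, the first member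
  is disjoint from \<open>regularize b\<close>.\<close>

lemma rather_below_regularize_le:
  assumes "rather_below b a"
  shows "regularize b \<le> a"
proof (rule le_of_inf_le_of_sup_eq_top[OF assms[unfolded rather_below_def]])
  show "inf (regularize b) (pseudocomplement b) \<le> a" by (subst inf_commute) simp
qed simp

text \<open>Only regularizations at each \<open>q\<close> can be compared. Stepping down from
  \<open>q\<close> to \<open>p < q\<close> absorbs the regularization, and (r3) removes the
  step.\<close>

lemma inj_on_booleanize_comp: "inj_on (\<lambda>f. booleanize \<circ> f) {f. frame_hom (f :: real_frame \<Rightarrow> 'a::frame)}"
proof (rule inj_onI, unfold mem_Collect_eq)
  have le: "f (above p) \<le> g (above p)"
    if f: "frame_hom f" and g: "frame_hom g" and eq: "booleanize \<circ> f = booleanize \<circ> g"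
    for f g :: "real_frame \<Rightarrow> 'a" and p
  proof -
    have "f (above q) \<le> g (above p)" if "p < q" for q
    proof -
      have "f (above q) \<le> regularize (f (above q))" by (rule le_regularize)
      also have "\<dots> = regularize (g (above q))"
        using fun_cong[OF eq, of "above q"] by (metis booleanize.rep_eq comp_apply)
      also have "\<dots> \<le> g (above p)"
        by (rule rather_below_regularize_le[OF hom_above_rather_below[OF g that]])
      finally show ?thesis .
    qed
    then show ?thesis unfolding hom_above_SUP[OF f, of p] by (simp add: SUP_le_iff)
  qed
  fix f g :: "real_frame \<Rightarrow> 'a"
  assume "frame_hom f" "frame_hom g" "booleanize \<circ> f = booleanize \<circ> g"
  then show "f = g" by (intro hom_eqI antisym le) simp_all
qed

lemma riesz_embedding_booleanize:
  "riesz_embedding (cont_real TYPE('a::frame)) (cont_real TYPE('a booleanization)) (\<lambda>f. booleanize \<circ> f)"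
proof (intro riesz_embedding.intro riesz_embedding_axioms.intro riesz_space_cont_real)
  note \<beta> = frame_hom_booleanize
  show "(\<lambda>f. booleanize \<circ> f) \<in> carrier (cont_real TYPE('a)) \<rightarrow> carrier (cont_real TYPE('a booleanization))"
    by (simp add: frame_hom_comp \<beta>)
  show "inj_on (\<lambda>f. booleanize \<circ> f) (carrier (cont_real TYPE('a)))"
    using inj_on_booleanize_comp by simp
qed (simp_all add: comp_add comp_scale comp_join comp_meet frame_hom_booleanize)


section \<open>Approximation from below\<close>

text \<open>A Urysohn function: the family witnessing \<open>b \<prec>\<prec> a\<close>, reversed and rescaled to \<open>[0, q]\<close>.\<close>

lemma ex_cont_bump:
  fixes a b :: "'a::frame"
  assumes "completely_below b a" "0 < q"
  obtains g where "frame_hom g" "\<And>p. p < 0 \<Longrightarrow> g (above p) = top" "\<And>p. 0 \<le> p \<Longrightarrow> g (above p) \<le> a"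
    "\<And>p. p < q \<Longrightarrow> b \<le> g (above p)" "\<And>p. q \<le> p \<Longrightarrow> g (above p) = bot"
proof -
  obtain c :: "rat \<Rightarrow> 'a" where c: "b \<le> c 0" "c 1 \<le> a"
    "\<And>r s. 0 \<le> r \<Longrightarrow> r < s \<Longrightarrow> s \<le> 1 \<Longrightarrow> rather_below (c r) (c s)"
    using assms(1) unfolding completely_below_def by blast
  \<comment> \<open>The scale must decrease while \<open>c\<close> increases: level 0 gets
    \<open>c 1\<close> and level \<open>q\<close> gets \<open>c 0\<close>. The values outside
    \<open>[0, q]\<close> make the joins of \<open>d\<close> and of its pseudocomplements
    top.\<close>
  define d where "d s = (if s < 0 then top else if s \<le> q then c (1 - s / q) else bot)" for s
  have "rather_below (d t) (d s)" if "s < t" for s t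
  proof (cases "0 \<le> s \<and> t \<le> q")
    case True
    then have "rather_below (c (1 - t / q)) (c (1 - s / q))"
      using that assms(2) by (intro c(3)) (simp_all add: divide_strict_right_mono)
    with True that show ?thesis by (simp add: d_def)
  next
    case False
    then have "d s = top \<or> d t = bot" using that assms(2) by (auto simp: d_def)
    then show ?thesis by (auto simp: rather_below_def)
  qed
  moreover have "(SUP s. d s) = top"
    by (rule top_le, rule SUP_upper2[of "- 1"]) (simp_all add: d_def)
  moreover have "(SUP s. pseudocomplement (d s)) = top"
    using assms(2) by (intro top_le SUP_upper2[of "q + 1"]) (simp_all add: d_def)
  ultimately obtain g where g: "frame_hom g" "\<And>p. g (above p) = (SUP s\<in>{s. p < s}. d s)"
    using hom_of_scale[of d] by blast
  have g_ge: "d s \<le> g (above p)" if "p < s" for p s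
    unfolding g(2) using that by (intro SUP_upper) simp
  have d_le: "d s \<le> a" if "0 < s" for s
  proof (cases "s \<le> q")
    case True
    \<comment> \<open>Positivity of \<open>s\<close> keeps the index strictly below 1, as
      \<open>c(3)\<close> demands.\<close>
    then have "rather_below (c (1 - s / q)) (c 1)"
      using that by (intro c(3)) simp_all
    then show ?thesis
      using True that rather_below_le c(2) by (auto simp: d_def intro: order_trans)
  qed (use that in \<open>simp add: d_def\<close>)
  show thesis
  proof (rule that[OF g(1)])
    fix p
    show "g (above p) = top" if "p < 0"
    proof -
      obtain s where "p < s" "s < 0" using dense[OF \<open>p < 0\<close>] by blast
      then show ?thesis using g_ge[of p s] by (simp add: d_def top_unique)
    qed
    show "g (above p) \<le> a" if "0 \<le> p"
      unfolding g(2) using that by (intro SUP_least d_le) simp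
    show "b \<le> g (above p)" if "p < q"
      using g_ge[OF that] c(1) assms(2) by (simp add: d_def)
    show "g (above p) = bot" if "q \<le> p"
      unfolding g(2) using that assms(2)
      by (intro bot_unique[THEN iffD1] SUP_least) (simp add: d_def)
  qed
qed

text \<open>Any upper bound \<open>u\<close> dominates \<open>h\<close>: at \<open>p \<ge> 0\<close>
  it suffices by (r3) to treat \<open>h (above q)\<close> for \<open>q > p\<close>, a join of images
  of elements \<open>b\<close>, each reached by a bump of height \<open>q\<close>.\<close>

lemma booleanize_approximation:
  fixes h :: "real_frame \<Rightarrow> 'a::frame booleanization"
  assumes regular: "completely_regular TYPE('a)"
    and h: "frame_hom h" and nonneg: "\<And>p. p < 0 \<Longrightarrow> h (above p) = top"
  shows "is_supremum (cont_real TYPE('a booleanization))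
    {booleanize \<circ> g | g. frame_hom g \<and> (\<forall>p<0. booleanize (g (above p)) = top) \<and>
      (\<forall>p. booleanize (g (above p)) \<le> h (above p))} h"
    (is "is_supremum _ ?A h")
proof (rule is_supremum_cont_real[OF _ h])
  note \<beta> = frame_hom_booleanize
  show "?A \<subseteq> {f. frame_hom f}" by (auto simp: frame_hom_comp \<beta>)
  fix u :: "real_frame \<Rightarrow> 'a booleanization" and p
  assume u: "frame_hom u" "\<And>f p. f \<in> ?A \<Longrightarrow> f (above p) \<le> u (above p)"
  have u_ge: "booleanize (g (above p)) \<le> u (above p)"
    if "frame_hom g" "\<And>p. p < 0 \<Longrightarrow> booleanize (g (above p)) = top"
      "\<And>p. booleanize (g (above p)) \<le> h (above p)" for g p
    using u(2)[of "booleanize \<circ> g"] that by auto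
  show "h (above p) \<le> u (above p)"
  proof (cases "p < 0")
    case True
    \<comment> \<open>The zero function is one of the approximants and forces \<open>u\<close> to be
      top at negative rationals.\<close>
    have "booleanize (cont_const 0 (above p) :: 'a) \<le> u (above p)"
      by (intro u_ge frame_hom_const)
        (simp_all add: const_above frame_hom_top[OF \<beta>] frame_hom_bot[OF \<beta>] nonneg)
    with True show ?thesis by (simp add: const_above frame_hom_top[OF \<beta>] top_unique)
  next
    case False
    have "h (above q) \<le> u (above p)" if "p < q" for q
    proof -
      \<comment> \<open>Complete regularity holds in the original frame, so the value is taken
        there; \<open>booleanize\<close> carries the resulting join back.\<close>
      define a where "a = Rep_booleanization (h (above q))"
      have ha: "h (above q) = booleanize a" by (simp add: a_def booleanize_Rep)
      have "booleanize b \<le> u (above p)" if "completely_below b a" for b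
      proof -
        have "0 < q" using False \<open>p < q\<close> by simp
        from ex_cont_bump[OF that this]
        obtain g where g: "frame_hom g" "\<And>p. p < 0 \<Longrightarrow> g (above p) = top"
          "\<And>p. 0 \<le> p \<Longrightarrow> g (above p) \<le> a" "\<And>p. p < q \<Longrightarrow> b \<le> g (above p)"
          "\<And>p. q \<le> p \<Longrightarrow> g (above p) = bot" by blast
        have "booleanize b \<le> booleanize (g (above p))"
          by (intro frame_hom_mono[OF \<beta>] g(4) \<open>p < q\<close>)
        also have "\<dots> \<le> u (above p)"
        proof (rule u_ge[OF g(1)])
          fix r
          show "booleanize (g (above r)) = top" if "r < 0"
            using that by (simp add: g(2) frame_hom_top[OF \<beta>])
          \<comment> \<open>In the middle range the bump stays under \<open>a\<close>, whose image
            \<open>h (above q)\<close> lies below \<open>h (above r)\<close>; outside it,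
            \<open>h\<close> is top or the bump is bottom.\<close>
          consider "r < 0" | "0 \<le> r" "r < q" | "q \<le> r" by linarith
          then show "booleanize (g (above r)) \<le> h (above r)"
          proof cases
            case 2
            have "booleanize (g (above r)) \<le> h (above q)"
              unfolding ha by (intro frame_hom_mono[OF \<beta>] g(3) 2)
            also have "\<dots> \<le> h (above r)" using 2 by (intro hom_above_antimono[OF h]) simp
            finally show ?thesis .
          qed (simp_all add: nonneg g(5) frame_hom_bot[OF \<beta>])
        qed
        finally show ?thesis .
      qed
      moreover have "a = Sup {b. completely_below b a}"
        using regular unfolding completely_regular_def by blast
      then have "booleanize a = (SUP b\<in>{b. completely_below b a}. booleanize b)"
        using frame_hom_Sup[OF \<beta>] by metis
      ultimately show ?thesis unfolding ha by (simp add: SUP_le_iff)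
    qed
    then show ?thesis unfolding hom_above_SUP[OF h, of p] by (simp add: SUP_le_iff)
  qed
qed auto

theorem theorem3p2:
  assumes "completely_regular TYPE('a::frame)"
  shows "universal_completion (cont_real TYPE('a)) (cont_real TYPE('a booleanization))
    (\<lambda>f. booleanize \<circ> f)"
proof (intro universal_completion.intro universal_completion_axioms.intro riesz_embedding_booleanize)
  let ?U = "cont_real TYPE('a booleanization)"
  show "universally_complete ?U"
    unfolding universally_complete_def
    by (intro conjI boolean_dedekind_complete boolean_laterally_complete booleanization_boolean)
  fix h assume "h \<in> pos_cone ?U"
  then have "frame_hom h" "\<And>p. p < 0 \<Longrightarrow> h (above p) = top"
    by (simp_all add: pos_cone_def cont_nonneg_iff)
  from booleanize_approximation[OF assms this]
  show "is_supremum ?U {booleanize \<circ> g | g. g \<in> carrier (cont_real TYPE('a)) \<and>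
      \<zero>\<^bsub>?U\<^esub> \<sqsubseteq>\<^bsub>?U\<^esub> booleanize \<circ> g \<and> booleanize \<circ> g \<sqsubseteq>\<^bsub>?U\<^esub> h} h"
    by (simp add: cont_nonneg_iff)
qed

end
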